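(* Consider the inequality constrained retrospective approximation SQP algorithm described in the context. Assume: (i) $\chi\subset\mathbb{R}^n$ is a closed bounded convex set containing all iterates generated by the algorithm; $f$ and every subsampled objective $F_{S_k}$, $k\ge0$, are continuously differentiable with gradients Lipschitz continuous on $\chi$; $c_E,c_I$ are continuously differentiable with Jacobians $\nabla c_E^T,\nabla c_I^T$ Lipschitz continuous on $\chi$; the matrices $H_{k,j}$ are symmetric positive definite with $\mu_HI_n\preceq H_{k,j}\preceq\kappa_HI_n$ for constants $\kappa_H\ge\mu_H>0$; (ii) (extended MFCQ) for every $x\in\chi$, $\operatorname{rank}(\nabla c_E(x))=m_E$ and there is $u\in\mathbb{R}^n$ with $\nabla c_E(x)^Tu=0$ and $[\nabla c_I(x)^T]_iu>0$ for all $i$ with $[c_I(x)]_i\ge0$. Let $\kappa_g\ge 0$ be such that $\|\nabla f(x)\|\le\kappa_g$ for all $x\in\chi$. 1. (Finite-sum problem.) Assume $\|\nabla F(x,\xi)\|^2\le\omega_1^2\|\nabla f(x)\|^2+\omega_2^2$ for all $x\in\chi$, $\xi\in\mathcal{S}$, with constants $\omega_1,\omega_2\ge0$. Let $\theta,\hat\theta,a\ge0$, $\beta\in(0,1)$, and let the batch sizes be chosen so that for all $k\ge0$ $$\|\nabla f(x_{k,0})-g_{S_k}(x_{k,0})\|^2\le\theta^2\|d_{k,0}^{true}\|^2+a^2\beta^{2k},\qquad\|\nabla f(x_{k,N_k})-g_{S_k}(x_{k,N_k})\|^2\le\hat\theta^2\left(\theta^2\|d_{k,0}^{true}\|^2+a^2\beta^{2k}\right).$$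 If $0\le\gamma_k\le\gamma<1$, $\epsilon_k=\omega\|\nabla f(x_{k,0})-g_{S_k}(x_{k,0})\|+\hat\omega\beta^k$ with $\omega,\hat\omega\ge0$, and $a_1=\gamma+\theta(\omega+\mu_H^{-1}(\hat\theta+\gamma))<1$, then for all $k\ge0$ $$\|d_{k,N_k}^{true}\|\le\max\{a_1+\nu,\beta\}^{k+1}\max\left\{\|d_{0,0}^{true}\|,\tfrac{a_2}{\nu}\right\},$$ where $a_2=a(\omega+\mu_H^{-1}(\hat\theta+\gamma))+\hat\omega$ and $\nu>0$ is such that $a_1+\nu<1$. 2. (Expectation problem.) Assume $\mathbb{E}[\|\nabla f(x)-\nabla F(x,\xi)\|^2\mid x]\le\tilde\omega_1^2\|\nabla f(x)\|^2+\tilde\omega_2^2$ for all $x\in\chi$, with constants $\tilde\omega_1,\tilde\omega_2\ge0$, and that there are $\kappa_G\ge0$, $\kappa_\sigma>0$ with $\mathbb{E}[G_S^2]\le\kappa_G^2/|S|$ for every set $S$ of i.i.d. samples from $\mathcal{P}$ and $\operatorname{Var}(\nabla F(x_{k,0},\xi)\mid\mathcal{F}_k)\ge\kappa_G^2\kappa_\sigma^2$ for all $k\ge0$. Let $\tilde\theta,\tilde a\ge0$, $\tilde\beta\in(0,1)$, and let the batch sizes be chosen so that for all $k\ge0$ $$\mathbb{E}\left[\|\nabla f(x_{k,0})-g_{S_k}(x_{k,0})\|^2\mid\mathcal{F}_k\right]\le\tilde\theta^2\|d_{k,0}^{true}\|^2+\tilde a^2\tilde\beta^{2k}.$$ If $0\le\gamma_k\le\tilde\gamma<1$,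 $\epsilon_k=\tilde\omega\sqrt{\operatorname{Var}(\nabla F(x_{k,0},\xi)\mid\mathcal{F}_k)/|S_k|}$ with $\tilde\omega\ge0$, and $\tilde a_1=\tilde\gamma+\tilde\theta\left(\tilde\omega+\mu_H^{-1}\left(\frac{\epsilon_G+\kappa_g}{\kappa_\sigma}+\tilde\gamma\right)\right)<1$, then for all $k\ge0$ $$\mathbb{E}\left[\|d_{k,N_k}^{true}\|\right]\le\max\{\tilde a_1+\tilde\nu,\tilde\beta\}^{k+1}\max\left\{\|d_{0,0}^{true}\|,\tfrac{\tilde a_2}{\tilde\nu}\right\},$$ where $\tilde a_2=\tilde a\left[\tilde\omega+\mu_H^{-1}\left(\frac{\epsilon_G+\kappa_g}{\kappa_\sigma}+\tilde\gamma\right)\right]$ and $\tilde\nu>0$ is such that $\tilde a_1+\tilde\nu<1$.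
   Context: Problem: $\min_{x\in\mathbb{R}^n}f(x)$ s.t. $c_E(x)=0$, $c_I(x)\le0$, with $c_E:\mathbb{R}^n\to\mathbb{R}^{m_E}$, $c_I:\mathbb{R}^n\to\mathbb{R}^{m_I}$. Finite-sum problem: $f(x)=\frac{1}{|\mathcal{S}|}\sum_{\xi\in\mathcal{S}}F(x,\xi)$, $\mathcal{S}$ finite. Expectation problem: $f(x)=\mathbb{E}[F(x,\xi)]$, $\xi\sim\mathcal{P}$, with $\nabla f(x)=\mathbb{E}[\nabla F(x,\xi)]$. $\|\cdot\|$ is the Euclidean norm, $e_m$ the all-ones vector in $\mathbb{R}^m$, $[\cdot]_+$ the componentwise positive part. For a finite sample set $S$ ($S\subseteq\mathcal{S}$, resp. i.i.d. draws from $\mathcal{P}$): $F_S(x)=\frac1{|S|}\sum_{\xi\in S}F(x,\xi)$, $g_S(x)=\frac1{|S|}\sum_{\xi\in S}\nabla F(x,\xi)$. Algorithm (two versions: $l_\infty$ and $l_1$; fix one). Inputs: $|S_k|$, $\gamma_k\in[0,1)$, $\epsilon_k\ge0$, $x_{0,0}$, $\bar\tau>0$, $\epsilon_\sigma,\epsilon_\tau,\epsilon_\alpha,\eta\in(0,1)$, $0<\sigma_p<\sigma_d<\infty$. At outer iteration $k$ obtain $S_k$ (in the expectation case $|S_k|$ is determined by $\mathcal{F}_k$ and the samples are i.i.d., independent of $\mathcal{F}_k$), set $\tau_{k,-1}=\bar\tau$, and for $j=0,1,\dots$: (a) Solve the linear program: $l_\infty$ version: minimize $y$ over $y\ge0$,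 $p\in\mathbb{R}^n$, s.t. $-ye_{m_E}\le c_E(x_{k,j})+\nabla c_E(x_{k,j})^Tp\le ye_{m_E}$, $c_I(x_{k,j})+\nabla c_I(x_{k,j})^Tp\le ye_{m_I}$, $\|p\|_\infty\le\sigma_p$; $l_1$ version: minimize $e_{m_E}^Ty_E+e_{m_I}^Ty_I$ over $y_E\ge0$, $y_I\ge0$, $p$, s.t. $-y_E\le c_E(x_{k,j})+\nabla c_E(x_{k,j})^Tp\le y_E$, $c_I(x_{k,j})+\nabla c_I(x_{k,j})^Tp\le y_I$, $\|p\|_1\le\sigma_p$. Let $p_{k,j}$ and $y$ (or $y_E,y_I$) be the solution; it depends only on $x_{k,j}$. If $p_{k,j}=0$ and $y>0$ (or $y_E\ne0$ or $y_I\neq0$), return $x_{k,j}$ as an infeasible stationary point. (b) Obtain $H_{k,j}$ and let $d_{k,j}$ be the minimizer of $g_{S_k}(x_{k,j})^Td+\frac12d^TH_{k,j}d$ s.t. ($l_\infty$) $-ye_{m_E}\le c_E(x_{k,j})+\nabla c_E(x_{k,j})^Td\le ye_{m_E}$, $c_I(x_{k,j})+\nabla c_I(x_{k,j})^Td\le ye_{m_I}$, $\|d\|_\infty\le\sigma_d$; or ($l_1$) $-y_E\le c_E(x_{k,j})+\nabla c_E(x_{k,j})^Td\le y_E$, $c_I(x_{k,j})+\nabla c_I(x_{k,j})^Td\le y_I$, $\|d\|_1\le\sigma_d$. (c) If $\|d_{k,j}\|\le\gamma_k\|d_{k,0}\|+\epsilon_k$, set $N_k=j$, $x_{k+1,0}=x_{k,N_k}$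 and go to outer iteration $k+1$. (d) Otherwise update the merit parameter: let $\Delta_c=\|(c_E(x_{k,j}),[c_I(x_{k,j})]_+)\|_\infty-y$ (resp. $\|(c_E(x_{k,j}),[c_I(x_{k,j})]_+)\|_1-e_{m_E}^Ty_E-e_{m_I}^Ty_I$), $q=g_{S_k}(x_{k,j})^Td_{k,j}+d_{k,j}^TH_{k,j}d_{k,j}$, $\tau^{trial}_{k,j}=\infty$ if $q\le0$ and $(1-\epsilon_\sigma)\Delta_c/q$ otherwise; $\tau_{k,j}=\tau_{k,j-1}$ if $\tau_{k,j-1}\le\tau_{k,j}^{trial}$, else $\tau_{k,j}=\min\{(1-\epsilon_\tau)\tau_{k,j-1},\tau_{k,j}^{trial}\}$. Choose $\alpha_{k,j}$ by backtracking over $1,\epsilon_\alpha,\epsilon_\alpha^2,\dots$ on the merit function $\phi_{S_k}(x,\tau)=\tau F_{S_k}(x)+\|(c_E(x),[c_I(x)]_+)\|_\infty$ (resp. $\|\cdot\|_1$) with the acceptance condition $\phi_{S_k}(x_{k,j}+\alpha_{k,j}d_{k,j},\tau_{k,j})\le\phi_{S_k}(x_{k,j},\tau_{k,j})-\eta\alpha_{k,j}\Delta l$, $\Delta l=-\tau_{k,j}g_{S_k}(x_{k,j})^Td_{k,j}+\Delta_c$; set $x_{k,j+1}=x_{k,j}+\alpha_{k,j}d_{k,j}$. The Hessian approximation is carried over between outer iterations: $H_{k,0}=H_{k-1,N_{k-1}}$ for $k\ge1$. The run is assumed not to stop in step (a). $d_{k,j}^{true}$ denotes the solution of the quadratic program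 in (b) with $g_{S_k}(x_{k,j})$ replaced by $\nabla f(x_{k,j})$. $\mathcal{F}_k$ is the $\sigma$-algebra of $x_{0,0}$ and $S_0,\dots,S_{k-1}$; $\mathbb{E}[\cdot]=\mathbb{E}[\cdot\mid\mathcal{F}_0]$. $\operatorname{Var}(\nabla F(x_{k,0},\xi)\mid\mathcal{F}_k)=\mathbb{E}[\|\nabla F(x_{k,0},\xi)-\nabla f(x_{k,0})\|^2\mid\mathcal{F}_k]$. $G_S=\max_{x\in\chi}\frac{\|\nabla f(x)-g_S(x)\|}{\epsilon_G+\|\nabla f(x)\|}$, $\epsilon_G>0$ fixed. *)

theory Defs
  imports "HOL-Probability.Probability"
begin

definition grad :: "(real^'n \<Rightarrow> real) \<Rightarrow> real^'n \<Rightarrow> real^'n" where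
  "grad h x = (THE D. GDERIV h x :> D)"

definition C1_near :: "(real^'n) set \<Rightarrow> (real^'n \<Rightarrow> real) \<Rightarrow> bool" where
  "C1_near X h \<longleftrightarrow>
     (\<exists>U. open U \<and> X \<subseteq> U \<and> (\<forall>x\<in>U. h differentiable (at x)) \<and> continuous_on U (grad h))"

definition smooth_on :: "(real^'n) set \<Rightarrow> (real^'n \<Rightarrow> real) \<Rightarrow> bool" where
  "smooth_on X h \<longleftrightarrow> C1_near X h \<and> (\<exists>L. L-lipschitz_on X (grad h))"

text \<open>
  A map into \<open>\<real>\<^sup>m\<close> is a family of components \<open>c i\<close>, \<open>i < m\<close>, so that \<open>m = 0\<close> is allowed.
  The rows of its Jacobian are the gradients \<open>grad (c i)\<close>; the Lipschitz condition is stated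
  in the Frobenius norm.
\<close>

definition smooth_map_on :: "(real^'n) set \<Rightarrow> nat \<Rightarrow> (nat \<Rightarrow> real^'n \<Rightarrow> real) \<Rightarrow> bool" where
  "smooth_map_on X m c \<longleftrightarrow>
     (\<forall>i<m. C1_near X (c i)) \<and>
     (\<exists>L. \<forall>x\<in>X. \<forall>y\<in>X.
        L2_set (\<lambda>i. norm (grad (c i) x - grad (c i) y)) {..<m} \<le> L * dist x y)"

definition avg :: "'i set \<Rightarrow> ('i \<Rightarrow> 'v::real_vector) \<Rightarrow> 'v" where
  "avg A h = (1 / real (card A)) *\<^sub>R (\<Sum>i\<in>A. h i)"

definition loewner_le :: "real^'n^'n \<Rightarrow> real^'n^'n \<Rightarrow> bool" where
  "loewner_le A B \<longleftrightarrow> (\<forall>v. 0 \<le> v \<bullet> ((B - A) *v v))"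

datatype version = Linf | L1

record 'n sqp =
  ver :: version
  m_E :: nat
  m_I :: nat
  c_E :: "nat \<Rightarrow> real^'n \<Rightarrow> real"
  c_I :: "nat \<Rightarrow> real^'n \<Rightarrow> real"
  sigma_p :: real
  sigma_d :: real
  tau_bar :: real
  eps_sigma :: real
  eps_tau :: real
  eps_alpha :: real
  eta :: real

definition valid_inputs :: "('n::finite) sqp \<Rightarrow> bool" where
  "valid_inputs A \<longleftrightarrow>
     0 < tau_bar A \<and> 0 < sigma_p A \<and> sigma_p A < sigma_d A \<and>
     eps_sigma A \<in> {0<..<1} \<and> eps_tau A \<in> {0<..<1} \<and> eps_alpha A \<in> {0<..<1} \<and> eta A \<in> {0<..<1}"

text \<open>
  The rank of the matrix with columns \<open>grad (c_E A i) x\<close>, \<open>i < m_E A\<close>, is the dimension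
  of the span of its columns.
\<close>

definition extended_MFCQ :: "('n::finite) sqp \<Rightarrow> real^'n \<Rightarrow> bool" where
  "extended_MFCQ A x \<longleftrightarrow>
     dim ((\<lambda>i. grad (c_E A i) x) ` {..<m_E A}) = m_E A \<and>
     (\<exists>u. (\<forall>i<m_E A. grad (c_E A i) x \<bullet> u = 0) \<and>
          (\<forall>i<m_I A. 0 \<le> c_I A i x \<longrightarrow> 0 < grad (c_I A i) x \<bullet> u))"

text \<open>The norm of \<open>(c\<^sub>E(x), [c\<^sub>I(x)]\<^sub>+)\<close>; inserting \<open>0\<close> covers \<open>m_E A = m_I A = 0\<close>.\<close>

definition violation :: "('n::finite) sqp \<Rightarrow> real^'n \<Rightarrow> real" where
  "violation A x = (case ver A of
     Linf \<Rightarrow> Max (insert 0 ((\<lambda>i. \<bar>c_E A i x\<bar>) ` {..<m_E A} \<union> (\<lambda>i. max 0 (c_I A i x)) ` {..<m_I A}))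
   | L1 \<Rightarrow> (\<Sum>i<m_E A. \<bar>c_E A i x\<bar>) + (\<Sum>i<m_I A. max 0 (c_I A i x)))"

definition step_norm :: "('n::finite) sqp \<Rightarrow> real^'n \<Rightarrow> real" where
  "step_norm A d = (case ver A of Linf \<Rightarrow> infnorm d | L1 \<Rightarrow> (\<Sum>i\<in>UNIV. \<bar>d $ i\<bar>))"

text \<open>
  \<open>Uniform y\<close> is the scalar slack of the \<open>l\<^sub>\<infinity>\<close> linear program, \<open>Componentwise y\<^sub>E y\<^sub>I\<close> the
  pair of slack vectors of the \<open>l\<^sub>1\<close> one.
\<close>

datatype slack = Uniform real | Componentwise "nat \<Rightarrow> real" "nat \<Rightarrow> real"

fun slack_E :: "slack \<Rightarrow> nat \<Rightarrow> real" where
  "slack_E (Uniform y) i = y"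
| "slack_E (Componentwise y_E y_I) i = y_E i"

fun slack_I :: "slack \<Rightarrow> nat \<Rightarrow> real" where
  "slack_I (Uniform y) i = y"
| "slack_I (Componentwise y_E y_I) i = y_I i"

fun slack_ok :: "('n::finite) sqp \<Rightarrow> slack \<Rightarrow> bool" where
  "slack_ok A (Uniform y) \<longleftrightarrow> ver A = Linf \<and> 0 \<le> y"
| "slack_ok A (Componentwise y_E y_I) \<longleftrightarrow>
     ver A = L1 \<and> (\<forall>i<m_E A. 0 \<le> y_E i) \<and> (\<forall>i<m_I A. 0 \<le> y_I i)"

fun slack_total :: "('n::finite) sqp \<Rightarrow> slack \<Rightarrow> real" where
  "slack_total A (Uniform y) = y"
| "slack_total A (Componentwise y_E y_I) = (\<Sum>i<m_E A. y_E i) + (\<Sum>i<m_I A. y_I i)"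

fun slack_nonzero :: "('n::finite) sqp \<Rightarrow> slack \<Rightarrow> bool" where
  "slack_nonzero A (Uniform y) \<longleftrightarrow> 0 < y"
| "slack_nonzero A (Componentwise y_E y_I) \<longleftrightarrow> (\<exists>i<m_E A. y_E i \<noteq> 0) \<or> (\<exists>i<m_I A. y_I i \<noteq> 0)"

definition linearized_feasible :: "('n::finite) sqp \<Rightarrow> real^'n \<Rightarrow> slack \<Rightarrow> real^'n \<Rightarrow> bool" where
  "linearized_feasible A x y d \<longleftrightarrow>
     (\<forall>i<m_E A. - slack_E y i \<le> c_E A i x + grad (c_E A i) x \<bullet> d \<and>
                c_E A i x + grad (c_E A i) x \<bullet> d \<le> slack_E y i) \<and>
     (\<forall>i<m_I A. c_I A i x + grad (c_I A i) x \<bullet> d \<le> slack_I y i)"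

definition LP_solution :: "('n::finite) sqp \<Rightarrow> real^'n \<Rightarrow> (real^'n) \<times> slack \<Rightarrow> bool" where
  "LP_solution A x = is_arg_min (\<lambda>(p, y). slack_total A y)
     (\<lambda>(p, y). slack_ok A y \<and> linearized_feasible A x y p \<and> step_norm A p \<le> sigma_p A)"

definition QP_objective :: "real^'n \<Rightarrow> real^'n^'n \<Rightarrow> real^'n \<Rightarrow> real" where
  "QP_objective g H d = g \<bullet> d + (1/2) * (d \<bullet> (H *v d))"

definition QP_feasible :: "('n::finite) sqp \<Rightarrow> real^'n \<Rightarrow> slack \<Rightarrow> real^'n \<Rightarrow> bool" where
  "QP_feasible A x y d \<longleftrightarrow> linearized_feasible A x y d \<and> step_norm A d \<le> sigma_d A"

text \<open>
  A run in which every outer iteration \<open>k\<close> is completed, after \<open>last_inner R k\<close> inner steps.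
  Entries with second index beyond \<open>last_inner R k\<close> are irrelevant.
\<close>

record 'n run =
  iter :: "nat \<Rightarrow> nat \<Rightarrow> real^'n"
  hess :: "nat \<Rightarrow> nat \<Rightarrow> real^'n^'n"
  dir :: "nat \<Rightarrow> nat \<Rightarrow> real^'n"
  tau :: "nat \<Rightarrow> nat \<Rightarrow> real"
  alpha :: "nat \<Rightarrow> nat \<Rightarrow> real"
  last_inner :: "nat \<Rightarrow> nat"

definition tau_trial :: "('n::finite) sqp \<Rightarrow> real \<Rightarrow> real \<Rightarrow> ereal" where
  "tau_trial A dc q = (if q \<le> 0 then \<infinity> else ereal ((1 - eps_sigma A) * dc / q))"

definition tau_update :: "('n::finite) sqp \<Rightarrow> real \<Rightarrow> ereal \<Rightarrow> real" where
  "tau_update A t trial =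
     (if ereal t \<le> trial then t else min ((1 - eps_tau A) * t) (real_of_ereal trial))"

definition merit :: "('n::finite) sqp \<Rightarrow> (real^'n \<Rightarrow> real) \<Rightarrow> real^'n \<Rightarrow> real \<Rightarrow> real" where
  "merit A F x t = t * F x + violation A x"

definition accepted ::
  "('n::finite) sqp \<Rightarrow> (real^'n \<Rightarrow> real) \<Rightarrow> real^'n \<Rightarrow> real^'n \<Rightarrow> real \<Rightarrow> real \<Rightarrow> real \<Rightarrow> bool" where
  "accepted A F x d t dl s \<longleftrightarrow> merit A F (x + s *\<^sub>R d) t \<le> merit A F x t - eta A * s * dl"

definition backtracking :: "('n::finite) sqp \<Rightarrow> (real \<Rightarrow> bool) \<Rightarrow> real \<Rightarrow> bool" where
  "backtracking A acc s \<longleftrightarrow>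
     (\<exists>i. s = eps_alpha A ^ i \<and> acc (eps_alpha A ^ i) \<and> (\<forall>l<i. \<not> acc (eps_alpha A ^ l)))"

text \<open>
  \<open>lp x\<close> is the solution \<open>(p, y)\<close> of the linear program chosen at \<open>x\<close>. Making it a function
  of \<open>x\<close> alone matters for the \<open>l\<^sub>1\<close> version, where the optimal slacks need not be unique.
  \<open>Fs k\<close> and \<open>gs k\<close> are the subsampled objective and gradient of outer iteration \<open>k\<close>.
\<close>

definition inner_update ::
  "('n::finite) sqp \<Rightarrow> (real^'n \<Rightarrow> (real^'n) \<times> slack) \<Rightarrow> (real^'n \<Rightarrow> real) \<Rightarrow> (real^'n \<Rightarrow> real^'n) \<Rightarrow>
   'n run \<Rightarrow> nat \<Rightarrow> nat \<Rightarrow> bool" where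
  "inner_update A lp F g R k j \<longleftrightarrow>
     (let x = iter R k j; d = dir R k j; H = hess R k j;
          t_prev = (if j = 0 then tau_bar A else tau R k (j - 1));
          t = tau R k j;
          dc = violation A x - slack_total A (snd (lp x));
          q = g x \<bullet> d + d \<bullet> (H *v d);
          dl = - t * (g x \<bullet> d) + dc
      in t = tau_update A t_prev (tau_trial A dc q) \<and>
         backtracking A (accepted A F x d t dl) (alpha R k j) \<and>
         iter R k (Suc j) = x + alpha R k j *\<^sub>R d)"

definition sqp_run ::
  "('n::finite) sqp \<Rightarrow> (real^'n \<Rightarrow> (real^'n) \<times> slack) \<Rightarrow> (nat \<Rightarrow> real) \<Rightarrow> (nat \<Rightarrow> real) \<Rightarrow>
   (nat \<Rightarrow> real^'n \<Rightarrow> real) \<Rightarrow> (nat \<Rightarrow> real^'n \<Rightarrow> real^'n) \<Rightarrow> 'n run \<Rightarrow> bool" where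
  "sqp_run A lp \<gamma> \<epsilon> Fs gs R \<longleftrightarrow>
     (\<forall>k. iter R (Suc k) 0 = iter R k (last_inner R k) \<and> hess R (Suc k) 0 = hess R k (last_inner R k)) \<and>
     (\<forall>k. \<forall>j\<le>last_inner R k.
        LP_solution A (iter R k j) (lp (iter R k j)) \<and>
        \<not> (fst (lp (iter R k j)) = 0 \<and> slack_nonzero A (snd (lp (iter R k j)))) \<and>
        is_arg_min (QP_objective (gs k (iter R k j)) (hess R k j))
          (QP_feasible A (iter R k j) (snd (lp (iter R k j)))) (dir R k j) \<and>
        (norm (dir R k j) \<le> \<gamma> k * norm (dir R k 0) + \<epsilon> k \<longleftrightarrow> j = last_inner R k)) \<and>
     (\<forall>k. \<forall>j<last_inner R k. inner_update A lp (Fs k) (gs k) R k j)"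

definition iterates_in :: "(real^'n) set \<Rightarrow> ('n::finite) run \<Rightarrow> bool" where
  "iterates_in X R \<longleftrightarrow> (\<forall>k. \<forall>j\<le>last_inner R k. iter R k j \<in> X)"

definition hessians_bounded :: "real \<Rightarrow> real \<Rightarrow> ('n::finite) run \<Rightarrow> bool" where
  "hessians_bounded \<mu> \<kappa> R \<longleftrightarrow>
     (\<forall>k. \<forall>j\<le>last_inner R k. transpose (hess R k j) = hess R k j \<and>
        loewner_le (mat \<mu>) (hess R k j) \<and> loewner_le (hess R k j) (mat \<kappa>))"

definition true_dir ::
  "('n::finite) sqp \<Rightarrow> (real^'n \<Rightarrow> (real^'n) \<times> slack) \<Rightarrow> (real^'n \<Rightarrow> real) \<Rightarrow> 'n run \<Rightarrow>
   nat \<Rightarrow> nat \<Rightarrow> real^'n" where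
  "true_dir A lp f R k j =
     arg_min (QP_objective (grad f (iter R k j)) (hess R k j))
       (QP_feasible A (iter R k j) (snd (lp (iter R k j))))"

text \<open>
  Outer iteration \<open>k\<close> draws the samples \<open>\<xi> k 0, \<dots>, \<xi> k (b k - 1)\<close>; later values are irrelevant.
  \<open>history M P x0 b \<xi> k\<close> is the \<open>\<sigma>\<close>-algebra generated by \<open>x0\<close> and the batches of the outer
  iterations before \<open>k\<close>, including their sizes.
\<close>

definition history ::
  "'w measure \<Rightarrow> 'b measure \<Rightarrow> ('w \<Rightarrow> real^'n) \<Rightarrow> (nat \<Rightarrow> 'w \<Rightarrow> nat) \<Rightarrow> (nat \<Rightarrow> nat \<Rightarrow> 'w \<Rightarrow> 'b) \<Rightarrow>
   nat \<Rightarrow> 'w measure" where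
  "history M P x0 b \<xi> k = sigma (space M)
     ({x0 -` B \<inter> space M | B. B \<in> sets borel} \<union>
      {{\<omega> \<in> space M. b l \<omega> = m \<and> (\<lambda>i\<in>{..<m}. \<xi> l i \<omega>) \<in> C} | l m C.
         l < k \<and> C \<in> sets (PiM {..<m} (\<lambda>_. P))})"

text \<open>
  The batch size is determined by the \<open>\<sigma>\<close>-algebra \<open>G\<close>, and on the event that it equals \<open>m\<close> the
  samples are independent of \<open>G\<close> and distributed as \<open>m\<close> independent draws from \<open>P\<close>.
\<close>

definition iid_batch ::
  "'w measure \<Rightarrow> 'b measure \<Rightarrow> 'w measure \<Rightarrow> ('w \<Rightarrow> nat) \<Rightarrow> (nat \<Rightarrow> 'w \<Rightarrow> 'b) \<Rightarrow> bool" where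
  "iid_batch M P G b \<xi> \<longleftrightarrow>
     (\<forall>i. \<xi> i \<in> measurable M P) \<and>
     b \<in> measurable G (count_space UNIV) \<and> (\<forall>\<omega>\<in>space M. 0 < b \<omega>) \<and>
     (\<forall>E\<in>sets G. \<forall>m. \<forall>C\<in>sets (PiM {..<m} (\<lambda>_. P)).
        measure M {\<omega> \<in> E. b \<omega> = m \<and> (\<lambda>i\<in>{..<m}. \<xi> i \<omega>) \<in> C} =
        measure M {\<omega> \<in> E. b \<omega> = m} * measure (PiM {..<m} (\<lambda>_. P)) C)"

text \<open>
  \<open>Var(\<nabla>F(x,\<xi>) | G)\<close> for a \<open>G\<close>-measurable point \<open>x\<close>, where \<open>\<xi>\<close> has law \<open>P\<close> and is
  independent of \<open>G\<close>.
\<close>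

definition grad_cond_var ::
  "'w measure \<Rightarrow> 'w measure \<Rightarrow> (real^'n \<Rightarrow> 'b \<Rightarrow> real) \<Rightarrow> (real^'n \<Rightarrow> real) \<Rightarrow>
   ('w \<Rightarrow> real^'n) \<Rightarrow> ('w \<Rightarrow> 'b) \<Rightarrow> 'w \<Rightarrow> real" where
  "grad_cond_var M G F f x \<xi> =
     real_cond_exp M G (\<lambda>\<omega>. (norm (grad (\<lambda>z. F z (\<xi> \<omega>)) (x \<omega>) - grad f (x \<omega>)))\<^sup>2)"

text \<open>
  \<open>G\<^sub>S\<close> for a batch \<open>s\<close> of size \<open>m\<close>. The supremum is the maximum whenever the latter exists;
  it is taken in \<open>ennreal\<close> so that an unbounded quotient gives \<open>\<infinity>\<close>.
\<close>

definition G_sample ::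
  "(real^'n) set \<Rightarrow> real \<Rightarrow> (real^'n \<Rightarrow> 'b \<Rightarrow> real) \<Rightarrow> (real^'n \<Rightarrow> real) \<Rightarrow> nat \<Rightarrow> (nat \<Rightarrow> 'b) \<Rightarrow> ennreal" where
  "G_sample X \<epsilon>\<^sub>G F f m s =
     (SUP x\<in>X. ennreal (norm (grad f x - avg {..<m} (\<lambda>i. grad (\<lambda>z. F z (s i)) x)) /
                         (\<epsilon>\<^sub>G + norm (grad f x))))"

end

theory Submission
  imports Defs
begin

text \<open>
  The quadratic program has a \<open>\<mu>\<close>-strongly convex objective over a convex set, so its solution is
  \<open>\<mu>\<inverse>\<close>-Lipschitz in the gradient. Its data other than the gradient depend only on the iterate and
  the Hessian, both of which are carried over, so the true step at the end of outer iteration \<open>k\<close> is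
  the true step at the start of \<open>k + 1\<close>. With the termination test this gives, for
  \<open>D\<^sub>k = \<parallel>d\<^sub>k\<^sub>,\<^sub>0\<^sup>t\<^sup>r\<^sup>u\<^sup>e\<parallel>\<close> and the gradient errors \<open>\<delta>\<close> at the two ends of iteration \<open>k\<close>,
  \<open>D\<^sub>k\<^sub>+\<^sub>1 \<le> \<gamma> (D\<^sub>k + \<mu>\<inverse> \<delta>\<^sub>k\<^sub>,\<^sub>0) + \<epsilon>\<^sub>k + \<mu>\<inverse> \<delta>\<^sub>k\<^sub>,\<^sub>N\<close>, hence \<open>D\<^sub>k\<^sub>+\<^sub>1 \<le> a\<^sub>1 D\<^sub>k + a\<^sub>2 \<beta>\<^sup>k\<close>.

  In the expectation problem the same recursion holds conditionally on \<open>\<F>\<^sub>k\<close>. There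
  \<open>E[\<delta>\<^sub>k\<^sub>,\<^sub>0\<^sup>2 | \<F>\<^sub>k] = V\<^sub>k / b\<^sub>k\<close>, the variance of a mean, which bounds \<open>\<epsilon>\<^sub>k\<close> and, by Jensen,
  \<open>E[\<delta>\<^sub>k\<^sub>,\<^sub>0 | \<F>\<^sub>k]\<close>. The last iterate depends on the batch, so \<open>\<delta>\<^sub>k\<^sub>,\<^sub>N\<close> is bounded uniformly on \<open>X\<close> by
  \<open>(\<epsilon>\<^sub>G + \<kappa>\<^sub>g) G\<^sub>S\<close>.
\<close>

section \<open>The quadratic program\<close>

lemma symmetric_inner:
  fixes H :: "real^'n^'n"
  assumes "transpose H = H"
  shows "u \<bullet> (H *v v) = v \<bullet> (H *v u)"
  by (metis assms dot_lmul_matrix inner_commute transpose_matrix_vector)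

lemma mat_loewner_le:
  fixes H :: "real^'n^'n"
  assumes "loewner_le (mat \<mu>) H"
  shows "\<mu> * (norm v)\<^sup>2 \<le> v \<bullet> (H *v v)"
proof -
  have "mat \<mu> *v v = \<mu> *\<^sub>R v"
    by (simp add: vec_eq_iff matrix_vector_mult_def mat_def if_distrib if_distribR cong: if_cong)
  moreover have "0 \<le> v \<bullet> ((H - mat \<mu>) *v v)"
    using assms by (simp add: loewner_le_def)
  ultimately show ?thesis
    by (simp add: matrix_vector_mult_diff_rdistrib inner_diff_right power2_norm_eq_inner)
qed

text \<open>By convexity the point a fraction \<open>t\<close> of the way from \<open>d\<close> to
  \<open>e\<close> is feasible, and the objective changes by
  \<open>t * s + t\<^sup>2 / 2 * q\<close>. For small \<open>t\<close> the linear term decides the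
  sign, so a negative slope \<open>s\<close> would contradict minimality.\<close>

lemma QP_minimizer_variational:
  assumes sym: "transpose H = H" and "convex (Collect P)"
    and min: "is_arg_min (QP_objective g H) P d" and "P e"
  shows "0 \<le> (g + H *v d) \<bullet> (e - d)"
proof (rule ccontr)
  define s where "s = (g + H *v d) \<bullet> (e - d)"
  define q where "q = (e - d) \<bullet> (H *v (e - d))"
  assume "\<not> 0 \<le> (g + H *v d) \<bullet> (e - d)"
  then have s: "s < 0" by (simp add: s_def)
  have le: "0 \<le> t * s + t\<^sup>2 / 2 * q" if t: "0 < t" "t \<le> 1" for t :: real
  proof -
    have "P d" using min by (simp add: is_arg_min_def)
    have "P ((1 - t) *\<^sub>R d + t *\<^sub>R e)"
      using convexD[OF assms(2), of d e "1 - t" t] \<open>P d\<close> \<open>P e\<close> t by simp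
    then have "QP_objective g H d \<le> QP_objective g H ((1 - t) *\<^sub>R d + t *\<^sub>R e)"
      using min by (auto simp: is_arg_min_def not_less)
    also have "(1 - t) *\<^sub>R d + t *\<^sub>R e = d + t *\<^sub>R (e - d)"
      by (simp add: algebra_simps)
    also have "QP_objective g H (d + t *\<^sub>R (e - d)) = QP_objective g H d + (t * s + t\<^sup>2 / 2 * q)"
      using symmetric_inner[OF sym, of d "e - d"]
      by (simp add: QP_objective_def s_def q_def inner_add_left inner_add_right inner_commute
          matrix_vector_right_distrib matrix_vector_mult_scaleR power2_eq_square algebra_simps)
    finally show ?thesis by simp
  qed
  \<comment> \<open>The cap 1 keeps the point on the segment. The other bound gives
    \<open>t * q \<le> - s\<close>, so the quadratic term offsets at most half of the decrease
    \<open>s\<close>; adding 1 avoids division by zero when \<open>q = 0\<close>.\<close>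
  define t where "t = min 1 (- s / (\<bar>q\<bar> + 1))"
  have t: "0 < t" "t \<le> 1" using s by (auto simp: t_def divide_neg_pos)
  have "t \<le> - s / (\<bar>q\<bar> + 1)" by (simp add: t_def)
  then have "t * (\<bar>q\<bar> + 1) \<le> - s" by (simp add: field_simps)
  moreover have "t * q \<le> t * (\<bar>q\<bar> + 1)" using t by (intro mult_left_mono) auto
  ultimately have "s + t / 2 * q < 0" using s by simp
  then have "t * (s + t / 2 * q) < 0" using t by (simp add: mult_pos_neg)
  then show False using le[OF t] by (simp add: algebra_simps power2_eq_square)
qed

text \<open>Each minimizer is tested in the variational inequality of the other. In the sum, the
  quadratic form at \<open>d - e\<close> is at most \<open>(h - g) \<bullet> (d - e)\<close>. The
  lower bound on \<open>H\<close> and Cauchy-Schwarz then leave one factor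
  \<open>norm (d - e)\<close> to cancel, which is why \<open>d = e\<close> is treated apart.\<close>

lemma QP_minimizer_lipschitz:
  assumes sym: "transpose H = H" and H: "loewner_le (mat \<mu>) H" and "0 < \<mu>"
    and cvx: "convex (Collect P)"
    and d: "is_arg_min (QP_objective g H) P d" and e: "is_arg_min (QP_objective h H) P e"
  shows "norm (d - e) \<le> inverse \<mu> * norm (g - h)"
proof (cases "d = e")
  case False
  have "P d" "P e" using d e by (auto simp: is_arg_min_def)
  have "0 \<le> (g + H *v d) \<bullet> (e - d)" "0 \<le> (h + H *v e) \<bullet> (d - e)"
    using QP_minimizer_variational[OF sym cvx d \<open>P e\<close>] QP_minimizer_variational[OF sym cvx e \<open>P d\<close>]
    by auto
  then have "(d - e) \<bullet> (H *v (d - e)) \<le> (h - g) \<bullet> (d - e)"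
    by (simp add: inner_diff_right inner_diff_left inner_add_left matrix_vector_mult_diff_distrib
        inner_add_right inner_commute)
  also have "\<dots> \<le> norm (g - h) * norm (d - e)"
    by (metis norm_cauchy_schwarz norm_minus_commute)
  finally have "\<mu> * (norm (d - e))\<^sup>2 \<le> norm (g - h) * norm (d - e)"
    using mat_loewner_le[OF H, of "d - e"] by simp
  then have "\<mu> * norm (d - e) \<le> norm (g - h)"
    using False by (simp add: power2_eq_square flip: mult.assoc)
  then show ?thesis
    using \<open>0 < \<mu>\<close> by (simp add: field_simps)
qed (use \<open>0 < \<mu>\<close> in simp)

section \<open>Geometry of the feasible set: a norm ball cut by affine inequalities\<close>

lemma step_norm_triangle: "step_norm A (d + e) \<le> step_norm A d + step_norm A e"
  by (auto simp: step_norm_def infnorm_triangle sum.distrib[symmetric] intro!: sum_mono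
      split: version.split)

lemma step_norm_scaleR: "step_norm A (t *\<^sub>R d) = \<bar>t\<bar> * step_norm A d"
  by (simp add: step_norm_def infnorm_mul sum_distrib_left abs_mult split: version.split)

lemma continuous_on_step_norm: "continuous_on UNIV (step_norm A)"
  by (cases "ver A") (auto simp: step_norm_def[abs_def] intro!: continuous_intros)

text \<open>The factor is the one required by the sup norm. The sum norm dominates the Euclidean
  norm already with factor 1, so a single constant serves both versions.\<close>

lemma norm_le_step_norm:
  fixes d :: "real^'n"
  shows "norm d \<le> sqrt (real CARD('n)) * step_norm A d"
proof (cases "ver A")
  case Linf
  then show ?thesis using norm_le_infnorm[of d] by (simp add: step_norm_def)
next
  case L1
  have "norm d \<le> (\<Sum>i\<in>UNIV. \<bar>d $ i\<bar>)" by (rule norm_le_l1_cart)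
  also have "\<dots> \<le> sqrt (real CARD('n)) * (\<Sum>i\<in>UNIV. \<bar>d $ i\<bar>)"
    using mult_right_mono[of 1 "sqrt (real CARD('n))" "\<Sum>i\<in>UNIV. \<bar>d $ i\<bar>"]
    by (simp add: sum_nonneg)
  finally show ?thesis by (simp add: step_norm_def L1)
qed

lemma QP_feasible_norm_bound:
  fixes A :: "('n::finite) sqp"
  assumes "QP_feasible A x y d"
  shows "norm d \<le> sqrt (real CARD('n)) * sigma_d A"
proof -
  have "step_norm A d \<le> sigma_d A" using assms by (simp add: QP_feasible_def)
  then have "sqrt (real CARD('n)) * step_norm A d \<le> sqrt (real CARD('n)) * sigma_d A"
    by (intro mult_left_mono) auto
  then show ?thesis using norm_le_step_norm[of d A] by linarith
qed

lemma convex_QP_feasible: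
  fixes A :: "('n::finite) sqp"
  shows "convex (Collect (QP_feasible A x y))"
proof (rule convexI)
  fix d e :: "real^'n" and u v :: real
  assume d: "d \<in> Collect (QP_feasible A x y)" and e: "e \<in> Collect (QP_feasible A x y)"
    and uv: "0 \<le> u" "0 \<le> v" "u + v = 1"
  \<comment> \<open>Since \<open>u + v = 1\<close>, the constant term splits as well, and each
    linearized constraint at the combination is the same combination of its values at
    \<open>d\<close> and \<open>e\<close>.\<close>
  have affine: "c + w \<bullet> (u *\<^sub>R d + v *\<^sub>R e) = u * (c + w \<bullet> d) + v * (c + w \<bullet> e)" for c w
  proof -
    have "c = u * c + v * c" using uv by (metis distrib_right mult_1)
    then show ?thesis by (simp add: inner_add_right distrib_left)
  qed
  have le: "u * r + v * s \<le> b" if "r \<le> b" "s \<le> b" for r s b :: real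
    using convex_bound_le[OF that uv] .
  have ge: "b \<le> u * r + v * s" if "b \<le> r" "b \<le> s" for r s b :: real
    using le[of "-r" "-b" "-s"] that by simp
  have "step_norm A (u *\<^sub>R d + v *\<^sub>R e) \<le> u * step_norm A d + v * step_norm A e"
    using step_norm_triangle[of A "u *\<^sub>R d" "v *\<^sub>R e"] uv by (simp add: step_norm_scaleR)
  also have "\<dots> \<le> sigma_d A"
    using d e by (intro le) (auto simp: QP_feasible_def)
  finally show "u *\<^sub>R d + v *\<^sub>R e \<in> Collect (QP_feasible A x y)"
    using d e by (auto simp: QP_feasible_def linearized_feasible_def affine intro!: le ge)
qed

lemma compact_QP_feasible:
  fixes A :: "('n::finite) sqp"
  shows "compact (Collect (QP_feasible A x y))"
proof -
  have "closed (Collect (QP_feasible A x y))"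
    unfolding QP_feasible_def linearized_feasible_def
    by (intro closed_Collect_conj closed_Collect_all closed_Collect_imp closed_Collect_le
        continuous_intros continuous_on_step_norm) (auto simp: open_Collect_const)
  moreover have "bounded (Collect (QP_feasible A x y))"
    using QP_feasible_norm_bound by (fastforce simp: bounded_iff)
  ultimately show ?thesis by (simp add: compact_eq_bounded_closed)
qed

section \<open>Computed and true steps along a run\<close>

lemma sqp_run_feasible:
  assumes "sqp_run A lp \<gamma>s \<epsilon> Fs gs R" "j \<le> last_inner R k"
  shows "QP_feasible A (iter R k j) (snd (lp (iter R k j))) (dir R k j)"
  using assms by (auto simp: sqp_run_def is_arg_min_def)

text \<open>\<open>true_dir\<close> is a choice term, meaningful only once a minimizer is known to
  exist. One exists because the objective is continuous and the feasible set is compact and contains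
  the computed step.\<close>

lemma is_arg_min_true_dir:
  fixes A :: "('n::finite) sqp"
  assumes "sqp_run A lp \<gamma>s \<epsilon> Fs gs R" "j \<le> last_inner R k"
  shows "is_arg_min (QP_objective (grad f (iter R k j)) (hess R k j))
      (QP_feasible A (iter R k j) (snd (lp (iter R k j)))) (true_dir A lp f R k j)"
proof -
  let ?P = "QP_feasible A (iter R k j) (snd (lp (iter R k j)))"
  let ?q = "QP_objective (grad f (iter R k j)) (hess R k j)"
  have "continuous_on (Collect ?P) ?q"
    unfolding QP_objective_def
    by (intro continuous_intros linear_continuous_on_compose matrix_vector_mul_linear)
  then obtain e where "?P e" "\<forall>z. ?P z \<longrightarrow> ?q e \<le> ?q z"
    using continuous_attains_inf[OF compact_QP_feasible] sqp_run_feasible[OF assms] by blast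
  then have "is_arg_min ?q ?P e" by (auto simp: is_arg_min_def not_less)
  then show ?thesis unfolding true_dir_def arg_min_def by (rule someI)
qed

text \<open>This bound is the same for all runs and all iterations, which makes the true steps
  integrable in the expectation problem.\<close>

lemma norm_true_dir_bound:
  fixes A :: "('n::finite) sqp"
  assumes "sqp_run A lp \<gamma>s \<epsilon> Fs gs R" "j \<le> last_inner R k"
  shows "norm (true_dir A lp f R k j) \<le> sqrt (real CARD('n)) * sigma_d A"
  using is_arg_min_true_dir[OF assms, of f] QP_feasible_norm_bound
  by (auto simp: is_arg_min_def)

text \<open>Both sides are the same \<open>arg_min\<close> term: the iterate and the Hessian are
  copied, and the slacks agree because \<open>lp\<close> is a function of the point alone.\<close>

lemma true_dir_carry_over:
  assumes "sqp_run A lp \<gamma>s \<epsilon> Fs gs R"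
  shows "true_dir A lp f R (Suc k) 0 = true_dir A lp f R k (last_inner R k)"
  using assms by (simp add: true_dir_def sqp_run_def)

text \<open>The two programs share feasible set and Hessian and differ only in the linear term of
  the objective.\<close>

lemma dir_true_dir_diff:
  assumes run: "sqp_run A lp \<gamma>s \<epsilon> Fs gs R" and "hessians_bounded \<mu> \<kappa> R" and "0 < \<mu>"
    and j: "j \<le> last_inner R k"
  shows "norm (dir R k j - true_dir A lp f R k j)
    \<le> inverse \<mu> * norm (grad f (iter R k j) - gs k (iter R k j))"
proof -
  have "norm (dir R k j - true_dir A lp f R k j)
      \<le> inverse \<mu> * norm (gs k (iter R k j) - grad f (iter R k j))"
  proof (rule QP_minimizer_lipschitz[OF _ _ \<open>0 < \<mu>\<close> convex_QP_feasible])
    show "is_arg_min (QP_objective (gs k (iter R k j)) (hess R k j))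
        (QP_feasible A (iter R k j) (snd (lp (iter R k j)))) (dir R k j)"
      using run j by (simp add: sqp_run_def)
    show "is_arg_min (QP_objective (grad f (iter R k j)) (hess R k j))
        (QP_feasible A (iter R k j) (snd (lp (iter R k j)))) (true_dir A lp f R k j)"
      by (rule is_arg_min_true_dir[OF run j])
  qed (use assms in \<open>auto simp: hessians_bounded_def\<close>)
  then show ?thesis by (simp add: norm_minus_commute)
qed

text \<open>The chain runs from the true step at the last iterate to the computed one, by the
  termination test to the computed step at the first iterate, and from there to the true one. Each
  exchange of a true for a computed step costs \<open>inverse \<mu>\<close> times the gradient error
  at that point.\<close>

lemma norm_true_dir_recursion:
  fixes A :: "('n::finite) sqp" and f :: "real^'n \<Rightarrow> real"
  assumes run: "sqp_run A lp \<gamma>s \<epsilon> Fs gs R" and hess: "hessians_bounded \<mu> \<kappa> R" and "0 < \<mu>"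
    and \<gamma>: "0 \<le> \<gamma>s k" "\<gamma>s k \<le> \<gamma>"
  defines "\<delta> \<equiv> \<lambda>j. norm (grad f (iter R k j) - gs k (iter R k j))"
  shows "norm (true_dir A lp f R (Suc k) 0)
    \<le> \<gamma> * (norm (true_dir A lp f R k 0) + inverse \<mu> * \<delta> 0) + \<epsilon> k
        + inverse \<mu> * \<delta> (last_inner R k)"
proof -
  let ?N = "last_inner R k" and ?D = "true_dir A lp f R k"
  have diff: "norm (dir R k j - ?D j) \<le> inverse \<mu> * \<delta> j" if "j \<le> ?N" for j
    unfolding \<delta>_def by (rule dir_true_dir_diff[OF run hess \<open>0 < \<mu>\<close> that])
  have "norm (?D ?N) \<le> norm (dir R k ?N) + inverse \<mu> * \<delta> ?N"
    using diff[of ?N] norm_triangle_sub[of "?D ?N" "dir R k ?N"] by (simp add: norm_minus_commute)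
  moreover have "norm (dir R k ?N) \<le> \<gamma>s k * norm (dir R k 0) + \<epsilon> k"
    using run by (auto simp: sqp_run_def)
  moreover have "norm (dir R k 0) \<le> norm (?D 0) + inverse \<mu> * \<delta> 0"
    using diff[of 0] norm_triangle_sub[of "dir R k 0" "?D 0"] by simp
  then have "\<gamma>s k * norm (dir R k 0) \<le> \<gamma> * (norm (?D 0) + inverse \<mu> * \<delta> 0)"
    using \<gamma> by (intro mult_mono) auto
  ultimately show ?thesis by (simp add: true_dir_carry_over[OF run])
qed

section \<open>The linear recursion\<close>

text \<open>The margin \<open>\<nu>\<close> absorbs the inhomogeneous term:
  \<open>a\<^sub>2 \<le> \<nu> * m\<close> and \<open>\<beta> \<le> \<rho>\<close> bound it by
  \<open>\<nu> * m * \<rho> ^ k\<close>, so the factor of \<open>\<rho> ^ k * m\<close> rises from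
  \<open>a\<^sub>1\<close> to at most \<open>\<rho>\<close>.\<close>

lemma geometric_rate_step:
  fixes a\<^sub>1 a\<^sub>2 \<nu> \<beta> u v m :: real
  assumes "0 \<le> a\<^sub>1" "0 < \<nu>" "0 \<le> \<beta>" "0 \<le> m" "a\<^sub>2 / \<nu> \<le> m"
    and v: "v \<le> a\<^sub>1 * u + a\<^sub>2 * \<beta> ^ k" and u: "u \<le> max (a\<^sub>1 + \<nu>) \<beta> ^ k * m"
  shows "v \<le> max (a\<^sub>1 + \<nu>) \<beta> ^ Suc k * m"
proof -
  define \<rho> where "\<rho> = max (a\<^sub>1 + \<nu>) \<beta>"
  have "a\<^sub>2 * \<beta> ^ k \<le> \<nu> * m * \<beta> ^ k"
    using assms by (intro mult_right_mono) (auto simp: field_simps)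
  also have "\<dots> \<le> \<nu> * m * \<rho> ^ k"
    using assms by (intro mult_left_mono power_mono) (auto simp: \<rho>_def)
  finally have "v \<le> a\<^sub>1 * (\<rho> ^ k * m) + \<nu> * m * \<rho> ^ k"
    using v mult_left_mono[OF u \<open>0 \<le> a\<^sub>1\<close>] by (simp add: \<rho>_def)
  also have "\<dots> = (a\<^sub>1 + \<nu>) * (\<rho> ^ k * m)" by (simp add: algebra_simps)
  also have "\<dots> \<le> \<rho> * (\<rho> ^ k * m)"
    using assms by (intro mult_right_mono) (auto simp: \<rho>_def)
  finally show ?thesis by (simp add: \<rho>_def mult.assoc)
qed

text \<open>Turns the accuracy conditions, stated for squares, into bounds linear in the step length
  \<open>D\<close>, as the recursion requires.\<close>

lemma sqrt_le_add_of_squares: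
  assumes "0 \<le> \<theta>" "0 \<le> D" "0 \<le> a" "0 \<le> \<beta>"
  shows "sqrt (\<theta>\<^sup>2 * D\<^sup>2 + a\<^sup>2 * \<beta> ^ (2 * k)) \<le> \<theta> * D + a * \<beta> ^ k"
  using sqrt_sum_squares_le_sum[of "\<theta> * D" "a * \<beta> ^ k"] assms
  by (simp add: power_mult_distrib power_mult[symmetric] mult.commute)

text \<open>After taking roots, the gradient error is at most \<open>T\<close> at the first iterate
  and at most \<open>\<theta>' * T\<close> at the last one, with \<open>T\<close> affine in the
  current true step length. The recursion for the true steps thereby becomes linear.\<close>

lemma finite_sum_rate:
  fixes A :: "('n::finite) sqp"
  assumes run: "sqp_run A lp \<gamma>s \<epsilon> Fs gs R" and hess: "hessians_bounded \<mu> \<kappa> R" and \<mu>: "0 < \<mu>"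
    and nonneg: "0 \<le> \<theta>" "0 \<le> \<theta>'" "0 \<le> a" "0 < \<beta>" "0 \<le> \<omega>" "0 < \<nu>"
    and first: "\<And>k. (norm (grad f (iter R k 0) - gs k (iter R k 0)))\<^sup>2
        \<le> \<theta>\<^sup>2 * (norm (true_dir A lp f R k 0))\<^sup>2 + a\<^sup>2 * \<beta> ^ (2 * k)"
    and last: "\<And>k. (norm (grad f (iter R k (last_inner R k)) - gs k (iter R k (last_inner R k))))\<^sup>2
        \<le> \<theta>'\<^sup>2 * (\<theta>\<^sup>2 * (norm (true_dir A lp f R k 0))\<^sup>2 + a\<^sup>2 * \<beta> ^ (2 * k))"
    and \<gamma>: "\<And>k. 0 \<le> \<gamma>s k \<and> \<gamma>s k \<le> \<gamma>"
    and \<epsilon>: "\<And>k. \<epsilon> k = \<omega> * norm (grad f (iter R k 0) - gs k (iter R k 0)) + \<omega>' * \<beta> ^ k"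
    and a1: "a\<^sub>1 = \<gamma> + \<theta> * (\<omega> + inverse \<mu> * (\<theta>' + \<gamma>))"
    and a2: "a\<^sub>2 = a * (\<omega> + inverse \<mu> * (\<theta>' + \<gamma>)) + \<omega>'"
  shows "norm (true_dir A lp f R k (last_inner R k))
    \<le> max (a\<^sub>1 + \<nu>) \<beta> ^ (k + 1) * max (norm (true_dir A lp f R 0 0)) (a\<^sub>2 / \<nu>)"
proof -
  define D where "D k = norm (true_dir A lp f R k 0)" for k
  define m where "m = max (D 0) (a\<^sub>2 / \<nu>)"
  have "0 \<le> \<gamma>" using \<gamma>[of 0] by simp
  then have "0 \<le> a\<^sub>1" using nonneg \<mu> by (simp add: a1)
  have m: "0 \<le> m" "a\<^sub>2 / \<nu> \<le> m" by (auto simp: m_def D_def le_max_iff_disj)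
  have step: "D (Suc k) \<le> a\<^sub>1 * D k + a\<^sub>2 * \<beta> ^ k" for k
  proof -
    let ?\<delta> = "\<lambda>j. norm (grad f (iter R k j) - gs k (iter R k j))"
    define T where "T = \<theta> * D k + a * \<beta> ^ k"
    have T: "sqrt (\<theta>\<^sup>2 * (D k)\<^sup>2 + a\<^sup>2 * \<beta> ^ (2 * k)) \<le> T"
      unfolding T_def D_def using nonneg by (intro sqrt_le_add_of_squares) auto
    have 0: "?\<delta> 0 \<le> T"
      using real_le_rsqrt[OF first[of k]] T by (simp add: D_def)
    have "?\<delta> (last_inner R k) \<le> \<theta>' * sqrt (\<theta>\<^sup>2 * (D k)\<^sup>2 + a\<^sup>2 * \<beta> ^ (2 * k))"
      using real_le_rsqrt[OF last[of k]] nonneg by (simp add: D_def real_sqrt_mult)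
    also have "\<dots> \<le> \<theta>' * T" using T nonneg by (intro mult_left_mono) auto
    finally have N: "?\<delta> (last_inner R k) \<le> \<theta>' * T" .
    have "D (Suc k) \<le> \<gamma> * (D k + inverse \<mu> * ?\<delta> 0) + (\<omega> * ?\<delta> 0 + \<omega>' * \<beta> ^ k)
        + inverse \<mu> * ?\<delta> (last_inner R k)"
      using norm_true_dir_recursion[OF run hess \<mu>, of k \<gamma> f] \<gamma>[of k] by (simp add: D_def \<epsilon>)
    also have "\<dots> \<le> \<gamma> * (D k + inverse \<mu> * T) + (\<omega> * T + \<omega>' * \<beta> ^ k) + inverse \<mu> * (\<theta>' * T)"
      using 0 N nonneg \<mu> \<open>0 \<le> \<gamma>\<close> by (intro add_mono mult_left_mono order_refl) auto
    \<comment> \<open>Inserting \<open>T\<close> and collecting the coefficients of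
      \<open>D k\<close> and of \<open>\<beta> ^ k\<close> produces exactly the two
      constants.\<close>
    also have "\<dots> = a\<^sub>1 * D k + a\<^sub>2 * \<beta> ^ k"
      by (simp add: a1 a2 T_def algebra_simps)
    finally show ?thesis .
  qed
  have "D k \<le> max (a\<^sub>1 + \<nu>) \<beta> ^ k * m" for k
  proof (induction k)
    case 0
    then show ?case by (simp add: m_def)
  next
    case (Suc k)
    show ?case
      using geometric_rate_step[OF \<open>0 \<le> a\<^sub>1\<close> \<open>0 < \<nu>\<close> _ m step Suc] \<open>0 < \<beta>\<close> by simp
  qed
  \<comment> \<open>The step that ends iteration \<open>k\<close> starts iteration
    \<open>k + 1\<close>, hence the exponent \<open>k + 1\<close>.\<close>
  from this[of "Suc k"] show ?thesis
    by (simp add: D_def m_def true_dir_carry_over[OF run])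
qed

section \<open>Averages over an independent batch\<close>

text \<open>A coordinate projection pushes the product measure forward to \<open>P\<close>.\<close>

lemma
  fixes h :: "'b \<Rightarrow> 'v::{banach, second_countable_topology}"
  assumes "prob_space P" "i < m" and h: "h \<in> borel_measurable P"
  shows integrable_PiM_component:
      "integrable (PiM {..<m} (\<lambda>_. P)) (\<lambda>s. h (s i)) \<longleftrightarrow> integrable P h"
    and integral_PiM_component:
      "(\<integral>s. h (s i) \<partial>PiM {..<m} (\<lambda>_. P)) = (\<integral>\<zeta>. h \<zeta> \<partial>P)"
proof -
  have *: "distr (PiM {..<m} (\<lambda>_. P)) P (\<lambda>s. s i) = P"
    using assms by (intro distr_PiM_component) auto
  show "integrable (PiM {..<m} (\<lambda>_. P)) (\<lambda>s. h (s i)) \<longleftrightarrow> integrable P h"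
    using integrable_distr_eq[of "\<lambda>s. s i" "PiM {..<m} (\<lambda>_. P)" P h] * \<open>i < m\<close> h by simp
  show "(\<integral>s. h (s i) \<partial>PiM {..<m} (\<lambda>_. P)) = (\<integral>\<zeta>. h \<zeta> \<partial>P)"
    using integral_distr[of "\<lambda>s. s i" "PiM {..<m} (\<lambda>_. P)" P h] * \<open>i < m\<close> h by simp
qed

text \<open>The squared norm of the average expands into a double sum of inner products. The
  \<open>m\<close> diagonal terms each contribute the second moment; the others vanish because
  distinct coordinates are independent and \<open>Y\<close> has mean zero. The factor
  \<open>1 / m\<^sup>2\<close> leaves \<open>1 / m\<close>.\<close>

lemma integral_norm_sq_avg_PiM:
  fixes Y :: "'b \<Rightarrow> 'v::euclidean_space"
  assumes "prob_space P" and "0 < m"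
    and Y: "integrable P Y" "(\<integral>\<zeta>. Y \<zeta> \<partial>P) = 0" and Y2: "integrable P (\<lambda>\<zeta>. (norm (Y \<zeta>))\<^sup>2)"
  shows "integrable (PiM {..<m} (\<lambda>_. P)) (\<lambda>s. (norm (avg {..<m} (\<lambda>i. Y (s i))))\<^sup>2)"
    and "(\<integral>s. (norm (avg {..<m} (\<lambda>i. Y (s i))))\<^sup>2 \<partial>PiM {..<m} (\<lambda>_. P))
      = (\<integral>\<zeta>. (norm (Y \<zeta>))\<^sup>2 \<partial>P) / real m"
proof -
  interpret P: prob_space P by fact
  interpret product_sigma_finite "\<lambda>_. P" by standard
  let ?M = "PiM {..<m} (\<lambda>_. P)"
  have diag: "integrable ?M (\<lambda>s. Y (s i) \<bullet> Y (s i))"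
      "(\<integral>s. Y (s i) \<bullet> Y (s i) \<partial>?M) = (\<integral>\<zeta>. (norm (Y \<zeta>))\<^sup>2 \<partial>P)" if "i < m" for i
    using Y2 integrable_PiM_component[OF assms(1) that] integral_PiM_component[OF assms(1) that]
    by (auto simp: power2_norm_eq_inner dest: borel_measurable_integrable)
  have off: "integrable ?M (\<lambda>s. Y (s i) \<bullet> Y (s j))" "(\<integral>s. Y (s i) \<bullet> Y (s j) \<partial>?M) = 0"
    if "i < m" "j < m" "i \<noteq> j" for i j
  proof -
    \<comment> \<open>Inner products are expanded over the basis vectors \<open>e\<close>. Each
      summand is then written as a product over all coordinates, with the factor 1 away from
      \<open>i\<close> and \<open>j\<close>, so that the integral factorizes.\<close>
    define h where "h e l = (if l = i \<or> l = j then (\<lambda>\<zeta>. Y \<zeta> \<bullet> e) else (\<lambda>_. 1))" for e l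
    have h: "integrable P (h e l)" for e l using Y by (simp add: h_def)
    have eq: "(Y (s i) \<bullet> e) * (Y (s j) \<bullet> e) = (\<Prod>l<m. h e l (s l))" for e s
    proof -
      have "(\<Prod>l<m. h e l (s l)) = (\<Prod>l\<in>{i, j}. h e l (s l))"
        using that by (intro prod.mono_neutral_right) (auto simp: h_def)
      then show ?thesis using that by (simp add: h_def)
    qed
    have int: "integrable ?M (\<lambda>s. (Y (s i) \<bullet> e) * (Y (s j) \<bullet> e))" for e
      unfolding eq by (rule product_integrable_prod) (auto intro: h)
    have "(\<integral>s. (Y (s i) \<bullet> e) * (Y (s j) \<bullet> e) \<partial>?M) = (\<Prod>l<m. integral\<^sup>L P (h e l))" for e
      unfolding eq by (rule product_integral_prod) (auto intro: h)
    moreover have "integral\<^sup>L P (h e i) = 0" for e using Y by (simp add: h_def)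
    ultimately have 0: "(\<integral>s. (Y (s i) \<bullet> e) * (Y (s j) \<bullet> e) \<partial>?M) = 0" for e
      using that by (metis finite_lessThan lessThan_iff prod_zero)
    show "integrable ?M (\<lambda>s. Y (s i) \<bullet> Y (s j))"
      by (subst euclidean_inner) (intro Bochner_Integration.integrable_sum int)
    show "(\<integral>s. Y (s i) \<bullet> Y (s j) \<partial>?M) = 0"
      by (subst euclidean_inner) (simp add: Bochner_Integration.integral_sum int 0)
  qed
  have all: "integrable ?M (\<lambda>s. Y (s i) \<bullet> Y (s j))"
      "(\<integral>s. Y (s i) \<bullet> Y (s j) \<partial>?M) = (if j = i then (\<integral>\<zeta>. (norm (Y \<zeta>))\<^sup>2 \<partial>P) else 0)"
    if "i < m" "j < m" for i j
    using diag off that by (cases "j = i"; auto)+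
  have eq: "(norm (avg {..<m} (\<lambda>i. Y (s i))))\<^sup>2 = (1 / real m)\<^sup>2 * (\<Sum>i<m. \<Sum>j<m. Y (s i) \<bullet> Y (s j))"
    for s
    unfolding power2_norm_eq_inner avg_def
    by (simp add: inner_sum_left inner_sum_right power2_eq_square sum_divide_distrib inner_commute)
  show "integrable ?M (\<lambda>s. (norm (avg {..<m} (\<lambda>i. Y (s i))))\<^sup>2)"
    unfolding eq by (intro integrable_mult_right Bochner_Integration.integrable_sum all) auto
  have "(\<integral>s. (\<Sum>i<m. \<Sum>j<m. Y (s i) \<bullet> Y (s j)) \<partial>?M)
      = (\<Sum>i<m. \<Sum>j<m. \<integral>s. Y (s i) \<bullet> Y (s j) \<partial>?M)"
    by (subst Bochner_Integration.integral_sum, intro Bochner_Integration.integrable_sum all)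
      (auto intro!: sum.cong Bochner_Integration.integral_sum all)
  also have "\<dots> = (\<Sum>i<m. \<Sum>j<m. if j = i then (\<integral>\<zeta>. (norm (Y \<zeta>))\<^sup>2 \<partial>P) else 0)"
    by (intro sum.cong refl all) auto
  also have "\<dots> = real m * (\<integral>\<zeta>. (norm (Y \<zeta>))\<^sup>2 \<partial>P)"
    by simp
  finally show "(\<integral>s. (norm (avg {..<m} (\<lambda>i. Y (s i))))\<^sup>2 \<partial>?M)
      = (\<integral>\<zeta>. (norm (Y \<zeta>))\<^sup>2 \<partial>P) / real m"
    unfolding eq using \<open>0 < m\<close> by (simp add: power2_eq_square)
qed

lemma iid_batchD:
  assumes "iid_batch M P G b \<xi>"
  shows "\<xi> i \<in> measurable M P" and "b \<in> measurable G (count_space UNIV)"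
    and "\<omega> \<in> space M \<Longrightarrow> 0 < b \<omega>"
    and "E \<in> sets G \<Longrightarrow> C \<in> sets (PiM {..<m} (\<lambda>_. P)) \<Longrightarrow>
      measure M {\<omega> \<in> E. b \<omega> = m \<and> (\<lambda>i\<in>{..<m}. \<xi> i \<omega>) \<in> C} =
      measure M {\<omega> \<in> E. b \<omega> = m} * measure (PiM {..<m} (\<lambda>_. P)) C"
  using assms unfolding iid_batch_def by blast+

lemma measurable_batch:
  assumes "iid_batch M P G b \<xi>"
  shows "(\<lambda>\<omega>. \<lambda>i\<in>{..<m}. \<xi> i \<omega>) \<in> measurable M (PiM {..<m} (\<lambda>_. P))"
  by (rule measurable_restrict) (rule iid_batchD(1)[OF assms])

lemma measurable_batch_size:
  assumes "iid_batch M P G b \<xi>" "subalgebra M G"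
  shows "b \<in> measurable M (count_space UNIV)"
  using assms(2) iid_batchD(2)[OF assms(1)] by (rule measurable_from_subalg)

text \<open>On an event of \<open>G\<close> on which the batch has size \<open>m\<close>, the
  \<open>G\<close>-measurable data \<open>x\<close> and the batch are independent. The measures are
  compared on rectangles: \<open>E\<close> cut with the preimage of \<open>B\<close> under
  \<open>x\<close> is again in \<open>G\<close>, so the product rule in \<open>iid_batch\<close>
  applies. Restricting \<open>M\<close> without normalizing avoids dividing by a probability that
  may be zero.\<close>

lemma iid_batch_distr:
  fixes m :: nat
  assumes M: "prob_space M" and P: "prob_space P" and sub: "subalgebra M G"
    and iid: "iid_batch M P G b \<xi>" and x: "x \<in> measurable G N" and E: "E \<in> sets G"
  defines "Q \<equiv> density M (indicator {\<omega> \<in> E. b \<omega> = m})"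
  shows "distr Q N x \<Otimes>\<^sub>M PiM {..<m} (\<lambda>_. P)
    = distr Q (N \<Otimes>\<^sub>M PiM {..<m} (\<lambda>_. P)) (\<lambda>\<omega>. (x \<omega>, \<lambda>i\<in>{..<m}. \<xi> i \<omega>))"
proof -
  interpret M: prob_space M by fact
  let ?PP = "PiM {..<m} (\<lambda>_. P)" and ?s = "\<lambda>\<omega>. \<lambda>i\<in>{..<m}. \<xi> i \<omega>"
  interpret PP: prob_space ?PP using P by (intro prob_space_PiM)
  have space: "space G = space M" using sub by (simp add: subalgebra_def)
  have bG [measurable]: "b \<in> measurable G (count_space UNIV)" by (rule iid_batchD(2)[OF iid])
  have xG [measurable]: "x \<in> measurable G N" by fact
  have EG [measurable]: "E \<in> sets G" by fact
  have sM [measurable]: "?s \<in> measurable M ?PP" by (rule measurable_batch[OF iid])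
  have xM [measurable]: "x \<in> measurable M N" by (rule measurable_from_subalg[OF sub x])
  have GM: "B \<in> sets M" if "B \<in> sets G" for B using sub that by (auto simp: subalgebra_def)
  have EsM: "E \<subseteq> space M" using sets.sets_into_space[OF E] space by simp
  let ?E = "{\<omega> \<in> E. b \<omega> = m}"
  have "?E = E \<inter> (b -` {m} \<inter> space G)" using EsM space by auto
  also have "\<dots> \<in> sets G" by measurable
  finally have EmG: "?E \<in> sets G" .
  note Em [measurable] = GM[OF EmG]
  have emQ: "emeasure Q B = emeasure M (?E \<inter> B)" if "B \<in> sets M" for B
    unfolding Q_def using that by (subst emeasure_density) (auto simp: indicator_inter_arith[symmetric] Int_commute)
  have Qfin: "finite_measure Q"
    by (rule finite_measureI) (use emQ[of "space M"] in \<open>simp add: Q_def\<close>)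
  have setsQ [measurable_cong]: "sets Q = sets M" by (simp add: Q_def)
  have spQ: "space Q = space M" by (simp add: Q_def)
  have xQ: "x \<in> measurable Q N" using xM by (simp add: Q_def)
  have sQ: "?s \<in> measurable Q ?PP" using sM by (simp add: Q_def)
  show ?thesis
  proof (rule pair_measure_eqI)
    show "sigma_finite_measure (distr Q N x)"
      using finite_measure.finite_measure_distr[OF Qfin xQ]
      by (simp add: finite_measure.axioms)
    show "sigma_finite_measure ?PP" by unfold_locales
    show "sets (distr Q N x \<Otimes>\<^sub>M ?PP) = sets (distr Q (N \<Otimes>\<^sub>M ?PP) (\<lambda>\<omega>. (x \<omega>, ?s \<omega>)))"
      by simp
  next
    fix B C assume "B \<in> sets (distr Q N x)" and C: "C \<in> sets ?PP"
    then have B: "B \<in> sets N" by simp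
    let ?B = "x -` B \<inter> space M"
    have "E \<inter> (x -` B \<inter> space G) \<in> sets G" using B by measurable
    then have BG: "E \<inter> ?B \<in> sets G" by (simp add: space)
    have "measure M {\<omega> \<in> E \<inter> ?B. b \<omega> = m \<and> ?s \<omega> \<in> C}
        = measure M {\<omega> \<in> E \<inter> ?B. b \<omega> = m} * measure ?PP C"
      using iid BG C by (rule iid_batchD(4))
    then have indep: "emeasure M {\<omega> \<in> E \<inter> ?B. b \<omega> = m \<and> ?s \<omega> \<in> C}
        = ennreal (measure M {\<omega> \<in> E \<inter> ?B. b \<omega> = m} * measure ?PP C)"
      by (simp only: M.emeasure_eq_measure)
    have "emeasure (distr Q (N \<Otimes>\<^sub>M ?PP) (\<lambda>\<omega>. (x \<omega>, ?s \<omega>))) (B \<times> C)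
        = emeasure Q (?B \<inter> (?s -` C \<inter> space M))"
      using B C xQ sQ by (subst emeasure_distr) (auto simp: Q_def intro!: arg_cong2[where f=emeasure])
    also have "\<dots> = emeasure M (?E \<inter> (?B \<inter> (?s -` C \<inter> space M)))"
      using measurable_sets[OF xM B] measurable_sets[OF sM C] by (intro emQ) (rule sets.Int)
    also have "?E \<inter> (?B \<inter> (?s -` C \<inter> space M)) = {\<omega> \<in> E \<inter> ?B. b \<omega> = m \<and> ?s \<omega> \<in> C}"
      by auto
    also note indep
    also have "{\<omega> \<in> E \<inter> ?B. b \<omega> = m} = ?E \<inter> ?B"
      by auto
    also have "ennreal (measure M (?E \<inter> ?B) * measure ?PP C) = emeasure M (?E \<inter> ?B) * emeasure ?PP C"
      by (simp add: ennreal_mult M.emeasure_eq_measure PP.emeasure_eq_measure)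
    also have "emeasure M (?E \<inter> ?B) = emeasure (distr Q N x) B"
      using emQ[OF measurable_sets[OF xM B]] B xQ by (simp add: emeasure_distr spQ)
    finally show "emeasure (distr Q N x) B * emeasure ?PP C
        = emeasure (distr Q (N \<Otimes>\<^sub>M ?PP) (\<lambda>\<omega>. (x \<omega>, ?s \<omega>))) (B \<times> C)" by (rule sym)
  qed
qed

text \<open>
  Given \<open>G\<close>, the batch may be integrated out against the product measure with the
  \<open>G\<close>-measurable data \<open>x\<close> and \<open>b\<close> frozen.
\<close>

lemma iid_batch_nn_integral:
  assumes M: "prob_space M" and P: "prob_space P" and sub: "subalgebra M G"
    and iid: "iid_batch M P G b \<xi>" and x: "x \<in> measurable G N" and E: "E \<in> sets G"
    and H: "\<And>m. H m \<in> borel_measurable (N \<Otimes>\<^sub>M PiM {..<m} (\<lambda>_. P))"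
  shows "(\<integral>\<^sup>+\<omega>\<in>E. H (b \<omega>) (x \<omega>, \<lambda>i\<in>{..<b \<omega>}. \<xi> i \<omega>) \<partial>M)
    = (\<integral>\<^sup>+\<omega>\<in>E. (\<integral>\<^sup>+s. H (b \<omega>) (x \<omega>, s) \<partial>PiM {..<b \<omega>} (\<lambda>_. P)) \<partial>M)"
proof -
  let ?PP = "\<lambda>m. PiM {..<m} (\<lambda>_. P)" and ?s = "\<lambda>m \<omega>. \<lambda>i\<in>{..<m}. \<xi> i \<omega>"
  define u where "u m \<omega> = H m (x \<omega>, ?s m \<omega>)" for m \<omega>
  define v where "v m \<omega> = (\<integral>\<^sup>+s. H m (x \<omega>, s) \<partial>?PP m)" for m \<omega>
  have PP: "sigma_finite_measure (?PP m)" for m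
    by (intro prob_space_imp_sigma_finite prob_space_PiM P)
  have bM [measurable]: "b \<in> measurable M (count_space UNIV)" by (rule measurable_batch_size[OF iid sub])
  have xM [measurable]: "x \<in> measurable M N" by (rule measurable_from_subalg[OF sub x])
  have sM [measurable]: "?s m \<in> measurable M (?PP m)" for m by (rule measurable_batch[OF iid])
  have EM [measurable]: "E \<in> sets M" using E sub by (auto simp: subalgebra_def)
  note H [measurable]
  have v0: "(\<lambda>z. \<integral>\<^sup>+s. H m (z, s) \<partial>?PP m) \<in> borel_measurable N" for m
    using sigma_finite_measure.borel_measurable_nn_integral_fst[OF PP H] .
  have [measurable]: "u m \<in> borel_measurable M" for m unfolding u_def by measurable
  have [measurable]: "v m \<in> borel_measurable M" for m
    unfolding v_def by (rule measurable_compose[OF xM v0])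
  \<comment> \<open>For a frozen size \<open>m\<close> this is Tonelli for the product law of
    \<open>x\<close> and the batch.\<close>
  have fixed: "(\<integral>\<^sup>+\<omega>. u m \<omega> * indicator {\<omega> \<in> E. b \<omega> = m} \<omega> \<partial>M)
      = (\<integral>\<^sup>+\<omega>. v m \<omega> * indicator {\<omega> \<in> E. b \<omega> = m} \<omega> \<partial>M)" for m
  proof -
    let ?E = "{\<omega> \<in> E. b \<omega> = m}"
    define Q where "Q = density M (indicator ?E)"
    have "?E = E \<inter> (b -` {m} \<inter> space M)" using sets.sets_into_space[OF EM] by auto
    then have Em [measurable]: "?E \<in> sets M" by simp
    have "(\<integral>\<^sup>+\<omega>. u m \<omega> * indicator ?E \<omega> \<partial>M) = (\<integral>\<^sup>+\<omega>. u m \<omega> \<partial>Q)"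
      unfolding Q_def by (subst nn_integral_density) (auto simp: mult.commute)
    also have "\<dots> = (\<integral>\<^sup>+z. H m z \<partial>distr Q (N \<Otimes>\<^sub>M ?PP m) (\<lambda>\<omega>. (x \<omega>, ?s m \<omega>)))"
      unfolding u_def by (subst nn_integral_distr) (auto simp: Q_def)
    also have "\<dots> = (\<integral>\<^sup>+z. H m z \<partial>(distr Q N x \<Otimes>\<^sub>M ?PP m))"
      unfolding Q_def using iid_batch_distr[OF M P sub iid x E, of m] by simp
    also have "\<dots> = (\<integral>\<^sup>+z. (\<integral>\<^sup>+s. H m (z, s) \<partial>?PP m) \<partial>distr Q N x)"
      by (rule sigma_finite_measure.nn_integral_fst[OF PP, symmetric]) (simp add: H)
    also have "\<dots> = (\<integral>\<^sup>+\<omega>. v m \<omega> \<partial>Q)"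
      unfolding v_def by (rule nn_integral_distr) (use v0 in \<open>auto simp: Q_def\<close>)
    also have "\<dots> = (\<integral>\<^sup>+\<omega>. v m \<omega> * indicator ?E \<omega> \<partial>M)"
      unfolding Q_def by (subst nn_integral_density) (auto simp: mult.commute)
    finally show ?thesis .
  qed
  \<comment> \<open>The space of batches changes with their size, so the random size is handled by a
    countable partition; at each point only the term \<open>m = b \<omega>\<close> survives.\<close>
  have split: "(\<integral>\<^sup>+\<omega>\<in>E. w (b \<omega>) \<omega> \<partial>M) = (\<Sum>m. \<integral>\<^sup>+\<omega>. w m \<omega> * indicator {\<omega> \<in> E. b \<omega> = m} \<omega> \<partial>M)"
    if w: "\<And>m. w m \<in> borel_measurable M" for w :: "nat \<Rightarrow> _ \<Rightarrow> ennreal"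
  proof -
    have "w (b \<omega>) \<omega> * indicator E \<omega> = (\<Sum>m. w m \<omega> * indicator {\<omega> \<in> E. b \<omega> = m} \<omega>)" for \<omega>
    proof -
      have "(\<Sum>m. w m \<omega> * indicator {\<omega> \<in> E. b \<omega> = m} \<omega>)
          = (\<Sum>m\<in>{b \<omega>}. w m \<omega> * indicator {\<omega> \<in> E. b \<omega> = m} \<omega>)"
        by (rule suminf_finite) auto
      then show ?thesis by (simp add: indicator_def)
    qed
    moreover have "{\<omega> \<in> E. b \<omega> = m} \<in> sets M" for m
    proof -
      have "{\<omega> \<in> E. b \<omega> = m} = E \<inter> (b -` {m} \<inter> space M)" using sets.sets_into_space[OF EM] by auto
      then show ?thesis by simp
    qed
    ultimately show ?thesis
      using w by (simp add: nn_integral_suminf)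
  qed
  show ?thesis
    using split[of u] split[of v] fixed by (simp add: u_def v_def)
qed

lemma real_cond_exp_iid_batch:
  fixes H :: "nat \<Rightarrow> 'c \<times> (nat \<Rightarrow> 'b) \<Rightarrow> real"
  assumes M: "prob_space M" and P: "prob_space P" and sub: "subalgebra M G"
    and iid: "iid_batch M P G b \<xi>" and x: "x \<in> measurable G N"
    and H: "\<And>m. H m \<in> borel_measurable (N \<Otimes>\<^sub>M PiM {..<m} (\<lambda>_. P))"
    and nonneg: "\<And>m z. 0 \<le> H m z"
    and bound: "\<forall>m>0. \<forall>u\<in>space N. (\<integral>\<^sup>+s. ennreal (H m (u, s)) \<partial>PiM {..<m} (\<lambda>_. P)) \<le> ennreal B"
  shows "integrable M (\<lambda>\<omega>. H (b \<omega>) (x \<omega>, \<lambda>i\<in>{..<b \<omega>}. \<xi> i \<omega>))"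
    and "AE \<omega> in M. real_cond_exp M G (\<lambda>\<omega>. H (b \<omega>) (x \<omega>, \<lambda>i\<in>{..<b \<omega>}. \<xi> i \<omega>)) \<omega>
      = (\<integral>s. H (b \<omega>) (x \<omega>, s) \<partial>PiM {..<b \<omega>} (\<lambda>_. P))"
proof -
  let ?PP = "\<lambda>m. PiM {..<m} (\<lambda>_. P)" and ?s = "\<lambda>m \<omega>. \<lambda>i\<in>{..<m}. \<xi> i \<omega>"
  interpret M: prob_space M by fact
  interpret S: finite_measure_subalgebra M G by standard (rule sub)
  define u where "u \<omega> = H (b \<omega>) (x \<omega>, ?s (b \<omega>) \<omega>)" for \<omega>
  define v where "v \<omega> = (\<integral>\<^sup>+s. ennreal (H (b \<omega>) (x \<omega>, s)) \<partial>?PP (b \<omega>))" for \<omega>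
  have PP: "sigma_finite_measure (?PP m)" for m
    by (intro prob_space_imp_sigma_finite prob_space_PiM P)
  have bG: "b \<in> measurable G (count_space UNIV)" by (rule iid_batchD(2)[OF iid])
  have bM [measurable]: "b \<in> measurable M (count_space UNIV)" by (rule measurable_batch_size[OF iid sub])
  have xM [measurable]: "x \<in> measurable M N" by (rule measurable_from_subalg[OF sub x])
  have sM [measurable]: "?s m \<in> measurable M (?PP m)" for m by (rule measurable_batch[OF iid])
  note H [measurable]
  have eH: "(\<lambda>z. ennreal (H m z)) \<in> borel_measurable (N \<Otimes>\<^sub>M ?PP m)" for m by measurable
  have v0: "(\<lambda>z. \<integral>\<^sup>+s. ennreal (H m (z, s)) \<partial>?PP m) \<in> borel_measurable N" for m
    using sigma_finite_measure.borel_measurable_nn_integral_fst[OF PP eH] .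
  have vG: "v \<in> borel_measurable G"
    unfolding v_def by (rule measurable_compose_countable[OF _ bG]) (rule measurable_compose[OF x v0])
  have [measurable]: "v \<in> borel_measurable M" by (rule measurable_from_subalg[OF sub vG])
  have [measurable]: "u \<in> borel_measurable M"
    unfolding u_def by (rule measurable_compose_countable[OF _ bM]) measurable
  have b0: "0 < b \<omega>" if "\<omega> \<in> space M" for \<omega> using iid that by (rule iid_batchD(3))
  have vB: "v \<omega> \<le> ennreal B" if "\<omega> \<in> space M" for \<omega>
    unfolding v_def using bound b0[OF that] measurable_space[OF xM that] by blast
  \<comment> \<open>The bound \<open>B\<close> ensures that passing to \<open>enn2real\<close> loses
    nothing.\<close>
  have vfin: "ennreal (enn2real (v \<omega>)) = v \<omega>" if "\<omega> \<in> space M" for \<omega>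
    using vB[OF that] by (simp add: ennreal_enn2real_if) (metis ennreal_neq_top top.extremum_unique)
  have uv: "(\<integral>\<^sup>+\<omega>\<in>E. ennreal (u \<omega>) \<partial>M) = (\<integral>\<^sup>+\<omega>\<in>E. v \<omega> \<partial>M)" if "E \<in> sets G" for E
    unfolding u_def v_def
    using iid_batch_nn_integral[OF M P sub iid x that, of "\<lambda>m z. ennreal (H m z)"] eH by simp
  have vint: "(\<integral>\<^sup>+\<omega>. v \<omega> \<partial>M) < \<infinity>"
  proof -
    have "(\<integral>\<^sup>+\<omega>. v \<omega> \<partial>M) \<le> (\<integral>\<^sup>+\<omega>. ennreal B \<partial>M)" by (rule nn_integral_mono) (rule vB)
    also have "\<dots> < \<infinity>" by (simp add: M.emeasure_space_1 ennreal_less_top)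
    finally show ?thesis .
  qed
  have sp: "space G = space M" using sub by (simp add: subalgebra_def)
  have "(\<integral>\<^sup>+\<omega>. ennreal (u \<omega>) \<partial>M) = (\<integral>\<^sup>+\<omega>. v \<omega> \<partial>M)"
    using uv[OF sets.top] sp by simp
  then have u_int: "integrable M u"
    using vint nonneg by (intro integrableI_nonneg) (auto simp: u_def)
  then show "integrable M (\<lambda>\<omega>. H (b \<omega>) (x \<omega>, ?s (b \<omega>) \<omega>))" by (simp add: u_def[abs_def])
  have "(\<integral>\<^sup>+\<omega>. ennreal (enn2real (v \<omega>)) \<partial>M) = (\<integral>\<^sup>+\<omega>. v \<omega> \<partial>M)"
    by (rule nn_integral_cong) (rule vfin)
  then have v_int: "integrable M (\<lambda>\<omega>. enn2real (v \<omega>))"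
    using vint by (intro integrableI_nonneg) auto
  have "AE \<omega> in M. real_cond_exp M G u \<omega> = enn2real (v \<omega>)"
  proof (rule S.real_cond_exp_charact[OF _ u_int v_int])
    show "(\<lambda>\<omega>. enn2real (v \<omega>)) \<in> borel_measurable G" using vG by measurable
    fix E assume E: "E \<in> sets G"
    then have [measurable]: "E \<in> sets M" using sub by (auto simp: subalgebra_def)
    have conv: "(\<integral>\<omega>\<in>E. w \<omega> \<partial>M) = enn2real (\<integral>\<^sup>+\<omega>\<in>E. ennreal (w \<omega>) \<partial>M)"
      if [measurable]: "w \<in> borel_measurable M" and "\<And>\<omega>. 0 \<le> w \<omega>" for w :: "'a \<Rightarrow> real"
      unfolding set_lebesgue_integral_def using that
      by (subst integral_eq_nn_integral)
        (auto intro!: arg_cong[of _ _ enn2real] nn_integral_cong simp: indicator_def)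
    have "(\<integral>\<omega>\<in>E. u \<omega> \<partial>M) = enn2real (\<integral>\<^sup>+\<omega>\<in>E. v \<omega> \<partial>M)"
      unfolding uv[OF E, symmetric] by (rule conv) (auto simp: u_def[symmetric], simp add: u_def nonneg)
    also have "(\<integral>\<^sup>+\<omega>\<in>E. v \<omega> \<partial>M) = (\<integral>\<^sup>+\<omega>\<in>E. ennreal (enn2real (v \<omega>)) \<partial>M)"
      by (rule nn_integral_cong) (simp add: vfin)
    also have "enn2real \<dots> = (\<integral>\<omega>\<in>E. enn2real (v \<omega>) \<partial>M)"
      by (rule conv[symmetric]) auto
    finally show "(\<integral>\<omega>\<in>E. u \<omega> \<partial>M) = (\<integral>\<omega>\<in>E. enn2real (v \<omega>) \<partial>M)" .
  qed
  moreover have "enn2real (v \<omega>) = (\<integral>s. H (b \<omega>) (x \<omega>, s) \<partial>?PP (b \<omega>))" if "\<omega> \<in> space M" for \<omega>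
  proof -
    have "(\<lambda>s. H (b \<omega>) (x \<omega>, s)) \<in> borel_measurable (?PP (b \<omega>))"
      using measurable_space[OF xM that] by measurable
    then show ?thesis
      unfolding v_def by (subst integral_eq_nn_integral) (auto simp: nonneg)
  qed
  ultimately show "AE \<omega> in M. real_cond_exp M G (\<lambda>\<omega>. H (b \<omega>) (x \<omega>, ?s (b \<omega>) \<omega>)) \<omega>
      = (\<integral>s. H (b \<omega>) (x \<omega>, s) \<partial>?PP (b \<omega>))"
    by (auto simp: u_def[abs_def] elim!: AE_mp intro!: AE_I2)
qed

section \<open>Sampling errors of the batch gradients\<close>

text \<open>Whether a batch event lies in \<open>sets M\<close> depends on the measurability of the
  batch size, which is known only relative to the history of its own iteration. Hence the strong
  induction: the earlier histories must already be subalgebras.\<close>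

lemma
  assumes x0: "x0 \<in> borel_measurable M"
    and iid: "\<And>k. iid_batch M P (history M P x0 b \<xi> k) (b k) (\<xi> k)"
  shows subalgebra_history: "subalgebra M (history M P x0 b \<xi> k)"
    and subalgebra_history_0: "subalgebra (history M P x0 b \<xi> k) (history M P x0 b \<xi> 0)"
proof -
  define gen where "gen k = {x0 -` B \<inter> space M | B. B \<in> sets borel} \<union>
      {{\<omega> \<in> space M. b l \<omega> = m \<and> (\<lambda>i\<in>{..<m}. \<xi> l i \<omega>) \<in> C} | l m C.
         l < k \<and> C \<in> sets (PiM {..<m} (\<lambda>_. P))}" for k
  have history: "history M P x0 b \<xi> k = sigma (space M) (gen k)" for k
    by (simp add: history_def gen_def)
  have Pow: "gen k \<subseteq> Pow (space M)" for k by (auto simp: gen_def)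
  have space: "space (history M P x0 b \<xi> k) = space M" for k
    by (simp add: history space_measure_of_conv)
  have sets: "sets (history M P x0 b \<xi> k) = sigma_sets (space M) (gen k)" for k
    by (simp add: history Pow)
  show "subalgebra M (history M P x0 b \<xi> k)"
  proof (induction k rule: less_induct)
    case (less k)
    have "gen k \<subseteq> sets M"
    proof -
      have "{\<omega> \<in> space M. b l \<omega> = m \<and> (\<lambda>i\<in>{..<m}. \<xi> l i \<omega>) \<in> C} \<in> sets M"
        if "l < k" "C \<in> sets (PiM {..<m} (\<lambda>_. P))" for l m C
      proof -
        have "{\<omega> \<in> space M. b l \<omega> = m \<and> (\<lambda>i\<in>{..<m}. \<xi> l i \<omega>) \<in> C}
            = (b l -` {m} \<inter> space M) \<inter> ((\<lambda>\<omega>. \<lambda>i\<in>{..<m}. \<xi> l i \<omega>) -` C \<inter> space M)"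
          by auto
        also have "\<dots> \<in> sets M"
          using measurable_sets[OF measurable_batch_size[OF iid less[OF \<open>l < k\<close>]], of "{m}"]
            measurable_sets[OF measurable_batch[OF iid] that(2), of l]
          by (metis UNIV_I insert_subset sets.Int sets_count_space Pow_iff empty_subsetI subset_UNIV)
        finally show ?thesis .
      qed
      then show ?thesis using measurable_sets[OF x0] by (auto simp: gen_def)
    qed
    then show ?case
      using sets.sigma_sets_subset by (auto simp: subalgebra_def space sets)
  qed
  have "gen 0 \<subseteq> gen k" by (auto simp: gen_def)
  then show "subalgebra (history M P x0 b \<xi> k) (history M P x0 b \<xi> 0)"
    by (simp add: subalgebra_def space sets sigma_sets_mono')
qed

text \<open>Conditional Jensen for the square, followed by a root, which is legitimate since
  \<open>T\<close> is nonnegative. It converts bounds on conditional second moments into bounds on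
  conditional means.\<close>

lemma (in finite_measure_subalgebra) real_cond_exp_le_sqrt:
  assumes h: "h \<in> borel_measurable M" and h2: "integrable M (\<lambda>\<omega>. (h \<omega>)\<^sup>2)"
    and T: "AE \<omega> in M. real_cond_exp M F (\<lambda>\<omega>. (h \<omega>)\<^sup>2) \<omega> \<le> (T \<omega>)\<^sup>2 \<and> 0 \<le> T \<omega>"
  shows "AE \<omega> in M. real_cond_exp M F h \<omega> \<le> T \<omega>"
proof -
  have "AE \<omega> in M. (real_cond_exp M F h \<omega>)\<^sup>2 \<le> real_cond_exp M F (\<lambda>\<omega>. (h \<omega>)\<^sup>2) \<omega>"
    by (rule real_cond_exp_jensens_inequality(2)[where I = UNIV and q = power2])
      (use h h2 square_integrable_imp_integrable convex_power2 in auto)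
  with T show ?thesis
  proof eventually_elim
    case (elim \<omega>)
    then have "(real_cond_exp M F h \<omega>)\<^sup>2 \<le> (T \<omega>)\<^sup>2" by linarith
    then show ?case using elim by (auto intro: power2_le_imp_le)
  qed
qed

lemma measurable_grad_smooth_on:
  assumes "smooth_on X f"
  shows "grad f \<in> borel_measurable (restrict_space borel X)"
  using assms lipschitz_on_continuous_on
  by (auto simp: smooth_on_def intro!: borel_measurable_continuous_on_restrict)

text \<open>With the point frozen at \<open>u\<close>, the squared batch error integrates to
  \<open>v u / m\<close> and the squared error of the first sample to \<open>v u\<close>. Both
  conditional expectations are thus explicit, and their quotient is the batch size.\<close>

lemma
  fixes F :: "real^'n \<Rightarrow> 'b \<Rightarrow> real" and f :: "real^'n \<Rightarrow> real"
  assumes M: "prob_space M" and P: "prob_space P" and sub: "subalgebra M G"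
    and iid: "iid_batch M P G b \<xi>"
    and x: "x \<in> borel_measurable G" and xX: "\<And>\<omega>. \<omega> \<in> space M \<Longrightarrow> x \<omega> \<in> X"
    and gradF: "(\<lambda>(x, \<zeta>). grad (\<lambda>z. F z \<zeta>) x) \<in> borel_measurable (restrict_space borel X \<Otimes>\<^sub>M P)"
    and gradf: "grad f \<in> borel_measurable (restrict_space borel X)"
    and unbiased: "\<And>u. u \<in> X \<Longrightarrow> integrable P (\<lambda>\<zeta>. grad (\<lambda>z. F z \<zeta>) u)
      \<and> grad f u = (\<integral>\<zeta>. grad (\<lambda>z. F z \<zeta>) u \<partial>P)"
    and var: "\<And>u. u \<in> X \<Longrightarrow> integrable P (\<lambda>\<zeta>. (norm (grad f u - grad (\<lambda>z. F z \<zeta>) u))\<^sup>2)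
      \<and> (\<integral>\<zeta>. (norm (grad f u - grad (\<lambda>z. F z \<zeta>) u))\<^sup>2 \<partial>P) \<le> B"
  defines "\<delta> \<equiv> \<lambda>\<omega>. norm (grad f (x \<omega>) - avg {..<b \<omega>} (\<lambda>i. grad (\<lambda>z. F z (\<xi> i \<omega>)) (x \<omega>)))"
  shows measurable_batch_gradient_error: "\<delta> \<in> borel_measurable M"
    and integrable_batch_gradient_error_sq: "integrable M (\<lambda>\<omega>. (\<delta> \<omega>)\<^sup>2)"
    and real_cond_exp_batch_gradient_error_sq:
      "AE \<omega> in M. real_cond_exp M G (\<lambda>\<omega>. (\<delta> \<omega>)\<^sup>2) \<omega> = grad_cond_var M G F f x (\<xi> 0) \<omega> / real (b \<omega>)"
proof -
  let ?PP = "\<lambda>m. PiM {..<m} (\<lambda>_. P)" and ?N = "restrict_space borel X"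
  define Y where "Y u \<zeta> = grad f u - grad (\<lambda>z. F z \<zeta>) u" for u \<zeta>
  define v where "v u = (\<integral>\<zeta>. (norm (Y u \<zeta>))\<^sup>2 \<partial>P)" for u
  define H1 where "H1 m z = (case z of (u, s) \<Rightarrow>
      (norm (grad f u - avg {..<m} (\<lambda>i. grad (\<lambda>z. F z (s i)) u)))\<^sup>2)" for m and z :: "(real^'n) \<times> (nat \<Rightarrow> 'b)"
  \<comment> \<open>Coordinate 0 exists only in nonempty batches; the default 0 keeps
    \<open>H2 m\<close> measurable at \<open>m = 0\<close>.\<close>
  define H2 where "H2 m z = (case z of (u, s) \<Rightarrow> if 0 < m then (norm (Y u (s 0)))\<^sup>2 else 0)"
    for m :: nat and z :: "(real^'n) \<times> (nat \<Rightarrow> 'b)"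
  interpret M: prob_space M by fact
  interpret P: prob_space P by fact
  interpret finite_measure_subalgebra M G by standard (rule sub)
  have space: "space G = space M" using sub by (simp add: subalgebra_def)
  have xN: "x \<in> measurable G ?N"
    by (rule measurable_restrict_space2[OF _ x]) (use xX space in auto)
  have Y: "integrable P (Y u)" "(\<integral>\<zeta>. Y u \<zeta> \<partial>P) = 0" "integrable P (\<lambda>\<zeta>. (norm (Y u \<zeta>))\<^sup>2)" "v u \<le> B"
    if "u \<in> X" for u
    using unbiased[OF that] var[OF that] by (auto simp: Y_def[abs_def] v_def P.prob_space)
  note gradf [measurable]
  have comp: "(\<lambda>z. grad (\<lambda>w. F w (snd z i)) (fst z)) \<in> borel_measurable (?N \<Otimes>\<^sub>M ?PP m)"
    if "i < m" for i m
  proof -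
    have "(\<lambda>z. (fst z, snd z i)) \<in> measurable (?N \<Otimes>\<^sub>M ?PP m) (?N \<Otimes>\<^sub>M P)"
      using that by (intro measurable_Pair measurable_compose[OF measurable_snd measurable_component_singleton]) auto
    from measurable_compose[OF this gradF] show ?thesis by simp
  qed
  have H1m: "H1 m \<in> borel_measurable (?N \<Otimes>\<^sub>M ?PP m)" for m
  proof -
    have "(\<lambda>z. \<Sum>i<m. grad (\<lambda>w. F w (snd z i)) (fst z)) \<in> borel_measurable (?N \<Otimes>\<^sub>M ?PP m)"
      by (intro borel_measurable_sum comp) simp
    note [measurable] = this
    show ?thesis unfolding H1_def[abs_def] avg_def case_prod_beta by measurable
  qed
  have H2m: "H2 m \<in> borel_measurable (?N \<Otimes>\<^sub>M ?PP m)" for m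
  proof (cases "0 < m")
    case True
    note [measurable] = comp[OF True]
    show ?thesis unfolding H2_def[abs_def] Y_def case_prod_beta using True by simp
  qed (simp add: H2_def[abs_def] case_prod_beta)
  \<comment> \<open>The true gradient can be moved inside the average only for a nonempty batch,
    since \<open>avg\<close> over the empty set is 0.\<close>
  have H1_avg: "H1 m (u, s) = (norm (avg {..<m} (\<lambda>i. Y u (s i))))\<^sup>2" if "0 < m" for m u s
    using that by (simp add: H1_def avg_def Y_def sum_subtractf scaleR_diff_right sum_constant_scaleR del: sum_constant)
  have H1i: "integrable (?PP m) (\<lambda>s. H1 m (u, s))" "(\<integral>s. H1 m (u, s) \<partial>?PP m) = v u / real m"
    if "0 < m" "u \<in> X" for m u
    unfolding H1_avg[OF that(1)] v_def
    using integral_norm_sq_avg_PiM[OF P that(1) Y(1-3)[OF that(2)]] by auto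
  have H2i: "integrable (?PP m) (\<lambda>s. H2 m (u, s))" "(\<integral>s. H2 m (u, s) \<partial>?PP m) = v u"
    if "0 < m" "u \<in> X" for m u
    using that(1) Y(3)[OF that(2)] integrable_PiM_component[OF P that(1), of "\<lambda>\<zeta>. (norm (Y u \<zeta>))\<^sup>2"]
      integral_PiM_component[OF P that(1), of "\<lambda>\<zeta>. (norm (Y u \<zeta>))\<^sup>2"]
    by (auto simp: H2_def v_def dest: borel_measurable_integrable)
  have v0: "0 \<le> v u" for u by (simp add: v_def)
  have H1b: "\<forall>m>0. \<forall>u\<in>space ?N. (\<integral>\<^sup>+s. ennreal (H1 m (u, s)) \<partial>?PP m) \<le> ennreal B"
  proof (intro allI impI ballI)
    fix m u assume that: "0 < (m::nat)" "u \<in> space ?N"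
    have u: "u \<in> X" using that by (simp add: space_restrict_space)
    have "v u / real m \<le> v u" using v0[of u] that(1) mult_left_mono[of 1 "real m" "v u"]
      by (simp add: field_simps)
    also have "\<dots> \<le> B" by (rule Y(4)[OF u])
    finally show "(\<integral>\<^sup>+s. ennreal (H1 m (u, s)) \<partial>?PP m) \<le> ennreal B"
      using H1i[OF that(1) u] by (subst nn_integral_eq_integral) (auto simp: H1_def intro!: ennreal_leI)
  qed
  have H2b: "\<forall>m>0. \<forall>u\<in>space ?N. (\<integral>\<^sup>+s. ennreal (H2 m (u, s)) \<partial>?PP m) \<le> ennreal B"
  proof (intro allI impI ballI)
    fix m u assume that: "0 < (m::nat)" "u \<in> space ?N"
    have u: "u \<in> X" using that by (simp add: space_restrict_space)
    show "(\<integral>\<^sup>+s. ennreal (H2 m (u, s)) \<partial>?PP m) \<le> ennreal B"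
      using H2i[OF that(1) u] Y(4)[OF u]
      by (subst nn_integral_eq_integral) (auto simp: H2_def intro!: ennreal_leI)
  qed
  have nonneg: "0 \<le> H1 m z" "0 \<le> H2 m z" for m z
    by (auto simp: H1_def H2_def split: prod.split)
  note b0 = iid_batchD(3)[OF iid]
  have \<delta>: "(\<delta> \<omega>)\<^sup>2 = H1 (b \<omega>) (x \<omega>, \<lambda>i\<in>{..<b \<omega>}. \<xi> i \<omega>)" for \<omega>
  proof -
    have "avg {..<b \<omega>} (\<lambda>i. grad (\<lambda>z. F z ((\<lambda>i\<in>{..<b \<omega>}. \<xi> i \<omega>) i)) (x \<omega>))
        = avg {..<b \<omega>} (\<lambda>i. grad (\<lambda>z. F z (\<xi> i \<omega>)) (x \<omega>))"
      unfolding avg_def by (intro arg_cong[of _ _ "scaleR _"] sum.cong) auto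
    then show ?thesis by (simp add: H1_def \<delta>_def)
  qed
  note c1 = real_cond_exp_iid_batch[OF M P sub iid xN H1m nonneg(1) H1b]
  note c2 = real_cond_exp_iid_batch[OF M P sub iid xN H2m nonneg(2) H2b]
  show int: "integrable M (\<lambda>\<omega>. (\<delta> \<omega>)\<^sup>2)" unfolding \<delta> by (rule c1(1))
  have "(\<lambda>\<omega>. sqrt ((\<delta> \<omega>)\<^sup>2)) \<in> borel_measurable M" using int by measurable
  then show "\<delta> \<in> borel_measurable M" by (simp add: \<delta>_def)
  define W where "W \<omega> = (norm (grad (\<lambda>z. F z (\<xi> 0 \<omega>)) (x \<omega>) - grad f (x \<omega>)))\<^sup>2" for \<omega>
  have W: "W \<omega> = H2 (b \<omega>) (x \<omega>, \<lambda>i\<in>{..<b \<omega>}. \<xi> i \<omega>)" if "\<omega> \<in> space M" for \<omega>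
    using b0[OF that] by (simp add: W_def H2_def Y_def norm_minus_commute)
  have Wm: "W \<in> borel_measurable M"
    using borel_measurable_integrable[OF c2(1)] by (subst measurable_cong[OF W])
  have "AE \<omega> in M. real_cond_exp M G W \<omega>
      = real_cond_exp M G (\<lambda>\<omega>. H2 (b \<omega>) (x \<omega>, \<lambda>i\<in>{..<b \<omega>}. \<xi> i \<omega>)) \<omega>"
    using Wm borel_measurable_integrable[OF c2(1)] by (intro real_cond_exp_cong AE_I2 W)
  then show "AE \<omega> in M. real_cond_exp M G (\<lambda>\<omega>. (\<delta> \<omega>)\<^sup>2) \<omega>
      = grad_cond_var M G F f x (\<xi> 0) \<omega> / real (b \<omega>)"
    unfolding \<delta> grad_cond_var_def W_def[symmetric]
    using c1(2) c2(2) AE_space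
  proof eventually_elim
    case (elim \<omega>)
    then show ?case
      using H1i(2)[OF b0 xX] H2i(2)[OF b0 xX] by simp
  qed
qed

lemma
  fixes F :: "real^'n \<Rightarrow> 'b \<Rightarrow> real" and f :: "real^'n \<Rightarrow> real"
  assumes M: "prob_space M" and P: "prob_space P" and sub: "subalgebra M G"
    and iid: "iid_batch M P G b \<xi>"
    and Gm: "\<And>m. 0 < m \<Longrightarrow> G_sample X \<epsilon>\<^sub>G F f m \<in> borel_measurable (PiM {..<m} (\<lambda>_. P))"
    and Gb: "\<And>m. 0 < m \<Longrightarrow>
      (\<integral>\<^sup>+ s. (G_sample X \<epsilon>\<^sub>G F f m s)\<^sup>2 \<partial>(PiM {..<m} (\<lambda>_. P))) \<le> ennreal (\<kappa>\<^sub>G\<^sup>2 / real m)"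
  defines "\<Gamma> \<equiv> \<lambda>\<omega>. G_sample X \<epsilon>\<^sub>G F f (b \<omega>) (\<lambda>i\<in>{..<b \<omega>}. \<xi> i \<omega>)"
  shows AE_G_sample_finite: "AE \<omega> in M. \<Gamma> \<omega> < \<infinity>"
    and measurable_G_sample: "(\<lambda>\<omega>. enn2real (\<Gamma> \<omega>)) \<in> borel_measurable M"
    and integrable_G_sample_sq: "integrable M (\<lambda>\<omega>. (enn2real (\<Gamma> \<omega>))\<^sup>2)"
    and real_cond_exp_G_sample_sq:
      "AE \<omega> in M. real_cond_exp M G (\<lambda>\<omega>. (enn2real (\<Gamma> \<omega>))\<^sup>2) \<omega> \<le> \<kappa>\<^sub>G\<^sup>2 / real (b \<omega>)"
proof -
  let ?PP = "\<lambda>m. PiM {..<m} (\<lambda>_. P)" and ?s = "\<lambda>m \<omega>. \<lambda>i\<in>{..<m}. \<xi> i \<omega>"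
  \<comment> \<open>The hypotheses on \<open>G_sample\<close> concern positive sizes, so the value
    at size 0 is replaced by 0.\<close>
  define K where "K m s = (if 0 < m then G_sample X \<epsilon>\<^sub>G F f m s else 0)" for m s
  \<comment> \<open>The supremum over \<open>X\<close> involves no particular iterate, so the
    \<open>G\<close>-measurable data are a single point of type \<open>unit\<close>.\<close>
  define H where "H m z = (enn2real (K m (snd z)))\<^sup>2" for m and z :: "unit \<times> (nat \<Rightarrow> 'b)"
  interpret M: prob_space M by fact
  note b0 = iid_batchD(3)[OF iid]
  have space: "space G = space M" using sub by (simp add: subalgebra_def)
  have K [measurable]: "K m \<in> borel_measurable (?PP m)" for m
    using Gm by (cases "0 < m") (auto simp: K_def[abs_def])
  have \<Gamma>: "\<Gamma> \<omega> = K (b \<omega>) (?s (b \<omega>) \<omega>)" if "\<omega> \<in> space M" for \<omega>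
    using b0[OF that] by (simp add: \<Gamma>_def K_def)
  have x: "(\<lambda>_. ()) \<in> measurable G (count_space UNIV)" by simp
  have Kb: "(\<integral>\<^sup>+ s. (K m s)\<^sup>2 \<partial>?PP m) \<le> ennreal (\<kappa>\<^sub>G\<^sup>2 / real m)" if "0 < m" for m
    using Gb[OF that] that by (simp add: K_def)
  have le1: "\<kappa>\<^sub>G\<^sup>2 / real m \<le> \<kappa>\<^sub>G\<^sup>2" if "0 < m" for m
    using that mult_left_mono[of 1 "real m" "\<kappa>\<^sub>G\<^sup>2"] by (simp add: field_simps)
  have sM [measurable]: "?s m \<in> measurable M (?PP m)" for m by (rule measurable_batch[OF iid])
  have bM [measurable]: "b \<in> measurable M (count_space UNIV)" by (rule measurable_batch_size[OF iid sub])
  have KM: "(\<lambda>\<omega>. K (b \<omega>) (?s (b \<omega>) \<omega>)) \<in> borel_measurable M"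
    by (rule measurable_compose_countable[OF _ bM]) measurable
  have \<Gamma>M [measurable]: "\<Gamma> \<in> borel_measurable M"
    using KM by (subst measurable_cong[OF \<Gamma>])
  show "(\<lambda>\<omega>. enn2real (\<Gamma> \<omega>)) \<in> borel_measurable M" by measurable
  have "(\<integral>\<^sup>+\<omega>. (\<Gamma> \<omega>)\<^sup>2 \<partial>M) = (\<integral>\<^sup>+\<omega>\<in>space G. (K (b \<omega>) (?s (b \<omega>) \<omega>))\<^sup>2 \<partial>M)"
    by (intro nn_integral_cong) (simp add: \<Gamma> space)
  also have "\<dots> = (\<integral>\<^sup>+\<omega>\<in>space G. (\<integral>\<^sup>+ s. (K (b \<omega>) s)\<^sup>2 \<partial>?PP (b \<omega>)) \<partial>M)"
    using iid_batch_nn_integral[OF M P sub iid x sets.top, of "\<lambda>m z. (K m (snd z))\<^sup>2"] by simp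
  also have "\<dots> \<le> (\<integral>\<^sup>+\<omega>. ennreal (\<kappa>\<^sub>G\<^sup>2) \<partial>M)"
  proof (rule nn_integral_mono)
    fix \<omega> assume "\<omega> \<in> space M"
    then have "(\<integral>\<^sup>+ s. (K (b \<omega>) s)\<^sup>2 \<partial>?PP (b \<omega>)) \<le> ennreal (\<kappa>\<^sub>G\<^sup>2)"
      using Kb[OF b0] le1[OF b0] by (meson ennreal_leI order_trans)
    then show "(\<integral>\<^sup>+ s. (K (b \<omega>) s)\<^sup>2 \<partial>?PP (b \<omega>)) * indicator (space G) \<omega> \<le> ennreal (\<kappa>\<^sub>G\<^sup>2)"
      by (auto simp: indicator_def)
  qed
  also have "\<dots> < \<infinity>" by (simp add: M.emeasure_space_1)
  finally have "AE \<omega> in M. (\<Gamma> \<omega>)\<^sup>2 \<noteq> \<infinity>"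
    by (intro nn_integral_PInf_AE) auto
  then show "AE \<omega> in M. \<Gamma> \<omega> < \<infinity>"
    by (rule AE_mp) (auto simp: less_top[symmetric] power2_eq_square ennreal_mult_eq_top_iff)
  have Hm: "H m \<in> borel_measurable (count_space UNIV \<Otimes>\<^sub>M ?PP m)" for m
    unfolding H_def[abs_def] by measurable
  have Hb': "(\<integral>\<^sup>+s. ennreal (H m (u, s)) \<partial>?PP m) \<le> ennreal (\<kappa>\<^sub>G\<^sup>2 / real m)" if "0 < m" for m u
  proof -
    \<comment> \<open>Only an inequality, because \<open>enn2real\<close> sends \<infinity> to
      0.\<close>
    have "ennreal (H m (u, s)) \<le> (K m s)\<^sup>2" for s
      by (cases "K m s") (auto simp: H_def ennreal_power)
    then have "(\<integral>\<^sup>+s. ennreal (H m (u, s)) \<partial>?PP m) \<le> (\<integral>\<^sup>+ s. (K m s)\<^sup>2 \<partial>?PP m)"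
      by (rule nn_integral_mono)
    then show ?thesis using Kb[OF that] by (rule order_trans)
  qed
  have "(\<integral>\<^sup>+s. ennreal (H m (u, s)) \<partial>?PP m) \<le> ennreal (\<kappa>\<^sub>G\<^sup>2)"
    if "0 < m" for m u
    using Hb'[OF that] le1[OF that] by (meson ennreal_leI order_trans)
  then have Hb: "\<forall>m>0. \<forall>u\<in>space (count_space UNIV).
      (\<integral>\<^sup>+s. ennreal (H m (u, s)) \<partial>?PP m) \<le> ennreal (\<kappa>\<^sub>G\<^sup>2)" by simp
  have nonneg: "0 \<le> H m z" for m z by (simp add: H_def)
  note c = real_cond_exp_iid_batch[OF M P sub iid x Hm nonneg Hb]
  have H: "(enn2real (\<Gamma> \<omega>))\<^sup>2 = H (b \<omega>) ((), ?s (b \<omega>) \<omega>)" if "\<omega> \<in> space M" for \<omega>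
    using \<Gamma>[OF that] by (simp add: H_def)
  show int: "integrable M (\<lambda>\<omega>. (enn2real (\<Gamma> \<omega>))\<^sup>2)"
    using c(1) by (subst Bochner_Integration.integrable_cong[OF refl H])
  interpret finite_measure_subalgebra M G by standard (rule sub)
  have "AE \<omega> in M. real_cond_exp M G (\<lambda>\<omega>. (enn2real (\<Gamma> \<omega>))\<^sup>2) \<omega>
      = real_cond_exp M G (\<lambda>\<omega>. H (b \<omega>) ((), ?s (b \<omega>) \<omega>)) \<omega>"
    using borel_measurable_integrable[OF c(1)] borel_measurable_integrable[OF int]
    by (intro real_cond_exp_cong AE_I2 H)
  then show "AE \<omega> in M. real_cond_exp M G (\<lambda>\<omega>. (enn2real (\<Gamma> \<omega>))\<^sup>2) \<omega> \<le> \<kappa>\<^sub>G\<^sup>2 / real (b \<omega>)"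
    using c(2) AE_space
  proof eventually_elim
    case (elim \<omega>)
    have "(\<integral>s. H (b \<omega>) ((), s) \<partial>?PP (b \<omega>)) \<le> \<kappa>\<^sub>G\<^sup>2 / real (b \<omega>)"
      by (rule integral_real_bounded) (use Hb'[OF b0[OF elim(3)]] in auto)
    then show ?case using elim by simp
  qed
qed

text \<open>The bound holds at every point of \<open>X\<close>, including one that depends on the
  batch. Finiteness is required since otherwise \<open>enn2real\<close> would return 0 for the
  supremum.\<close>

lemma norm_gradient_error_le_G_sample:
  assumes x: "x \<in> X" and "0 < \<epsilon>\<^sub>G" and \<kappa>: "norm (grad f x) \<le> \<kappa>\<^sub>g"
    and fin: "G_sample X \<epsilon>\<^sub>G F f m s < \<infinity>"
  shows "norm (grad f x - avg {..<m} (\<lambda>i. grad (\<lambda>z. F z (s i)) x))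
    \<le> (\<epsilon>\<^sub>G + \<kappa>\<^sub>g) * enn2real (G_sample X \<epsilon>\<^sub>G F f m s)"
proof -
  define r where "r = norm (grad f x - avg {..<m} (\<lambda>i. grad (\<lambda>z. F z (s i)) x))"
  have pos: "0 < \<epsilon>\<^sub>G + norm (grad f x)" using \<open>0 < \<epsilon>\<^sub>G\<close> by (simp add: add_pos_nonneg)
  have "ennreal (r / (\<epsilon>\<^sub>G + norm (grad f x))) \<le> G_sample X \<epsilon>\<^sub>G F f m s"
    unfolding G_sample_def r_def by (rule SUP_upper[OF x])
  then have "enn2real (ennreal (r / (\<epsilon>\<^sub>G + norm (grad f x)))) \<le> enn2real (G_sample X \<epsilon>\<^sub>G F f m s)"
    using fin by (intro enn2real_mono) auto
  then have "r \<le> (\<epsilon>\<^sub>G + norm (grad f x)) * enn2real (G_sample X \<epsilon>\<^sub>G F f m s)"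
    using pos by (simp add: r_def field_simps)
  also have "\<dots> \<le> (\<epsilon>\<^sub>G + \<kappa>\<^sub>g) * enn2real (G_sample X \<epsilon>\<^sub>G F f m s)"
    using \<kappa> by (intro mult_right_mono) auto
  finally show ?thesis by (simp add: r_def)
qed

section \<open>The rate in expectation\<close>

text \<open>The pathwise recursion is first conditioned on \<open>\<F> k\<close>, where every error
  is bounded through the \<open>\<F> k\<close>-measurable quantity \<open>T\<close>. The tower
  property then brings these one-step bounds down to \<open>\<F> 0\<close> by induction.\<close>

lemma expectation_rate:
  fixes A :: "('n::finite) sqp" and F :: "real^'n \<Rightarrow> 'b \<Rightarrow> real" and f :: "real^'n \<Rightarrow> real"
    and M :: "'w measure" and R :: "'w \<Rightarrow> 'n run"
    and lp :: "real^'n \<Rightarrow> (real^'n) \<times> slack"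
    and P :: "'b measure" and b :: "nat \<Rightarrow> 'w \<Rightarrow> nat" and \<xi> :: "nat \<Rightarrow> nat \<Rightarrow> 'w \<Rightarrow> 'b"
    and V :: "nat \<Rightarrow> 'w \<Rightarrow> real"
  defines "D \<equiv> \<lambda>k \<omega>. norm (true_dir A lp f (R \<omega>) k 0)"
    and "x \<equiv> \<lambda>k \<omega>. iter (R \<omega>) k 0"
    and "\<F> \<equiv> history M P (\<lambda>\<omega>. iter (R \<omega>) 0 0) b \<xi>"
    and "g \<equiv> \<lambda>k \<omega> u. avg {..<b k \<omega>} (\<lambda>i. grad (\<lambda>z. F z (\<xi> k i \<omega>)) u)"
  assumes M: "prob_space M" and P: "prob_space P" and \<mu>: "0 < \<mu>"
    and smooth: "smooth_on X f"
    and gradF: "(\<lambda>(u, \<zeta>). grad (\<lambda>z. F z \<zeta>) u) \<in> borel_measurable (restrict_space borel X \<Otimes>\<^sub>M P)"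
    and unbiased: "\<And>u. u \<in> X \<Longrightarrow> integrable P (\<lambda>\<zeta>. grad (\<lambda>z. F z \<zeta>) u)
      \<and> grad f u = (\<integral>\<zeta>. grad (\<lambda>z. F z \<zeta>) u \<partial>P)"
    and var: "\<And>u. u \<in> X \<Longrightarrow> integrable P (\<lambda>\<zeta>. (norm (grad f u - grad (\<lambda>z. F z \<zeta>) u))\<^sup>2)
      \<and> (\<integral>\<zeta>. (norm (grad f u - grad (\<lambda>z. F z \<zeta>) u))\<^sup>2 \<partial>P) \<le> B"
    and \<kappa>\<^sub>g: "\<And>u. u \<in> X \<Longrightarrow> norm (grad f u) \<le> \<kappa>\<^sub>g"
    and x0: "x 0 \<in> borel_measurable M"
    and iid: "\<And>k. iid_batch M P (\<F> k) (b k) (\<xi> k)"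
    and xF: "\<And>k. x k \<in> borel_measurable (\<F> k)"
    and dF: "\<And>k. (\<lambda>\<omega>. true_dir A lp f (R \<omega>) k 0) \<in> borel_measurable (\<F> k)"
    and V: "\<And>k. V k = grad_cond_var M (\<F> k) F f (x k) (\<xi> k 0)"
    and run: "\<And>\<omega>. \<omega> \<in> space M \<Longrightarrow>
      sqp_run A lp (\<lambda>k. \<gamma>s k \<omega>) (\<lambda>k. \<epsilon> k \<omega>) (Fs \<omega>) (\<lambda>k. g k \<omega>) (R \<omega>)"
    and inX: "\<And>\<omega>. \<omega> \<in> space M \<Longrightarrow> iterates_in X (R \<omega>)"
    and hess: "\<And>\<omega>. \<omega> \<in> space M \<Longrightarrow> hessians_bounded \<mu> \<kappa> (R \<omega>)"
    and Gm: "\<And>m. 0 < m \<Longrightarrow> G_sample X \<epsilon>\<^sub>G F f m \<in> borel_measurable (PiM {..<m} (\<lambda>_. P))"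
    and Gb: "\<And>m. 0 < m \<Longrightarrow>
      (\<integral>\<^sup>+ s. (G_sample X \<epsilon>\<^sub>G F f m s)\<^sup>2 \<partial>(PiM {..<m} (\<lambda>_. P))) \<le> ennreal (\<kappa>\<^sub>G\<^sup>2 / real m)"
    and Vlow: "\<And>k. AE \<omega> in M. V k \<omega> \<ge> \<kappa>\<^sub>G\<^sup>2 * \<kappa>\<^sub>\<sigma>\<^sup>2"
    and batch: "\<And>k. AE \<omega> in M.
      real_cond_exp M (\<F> k) (\<lambda>\<omega>. (norm (grad f (x k \<omega>) - g k \<omega> (x k \<omega>)))\<^sup>2) \<omega>
        \<le> \<theta>\<^sup>2 * (D k \<omega>)\<^sup>2 + a\<^sup>2 * \<beta> ^ (2 * k)"
    and nonneg: "0 < \<epsilon>\<^sub>G" "0 < \<kappa>\<^sub>\<sigma>" "0 \<le> \<theta>" "0 \<le> a" "0 < \<beta>" "0 \<le> \<omega>'" "0 < \<nu>" "0 \<le> \<kappa>\<^sub>g"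
    and \<gamma>: "\<And>k \<omega>. \<omega> \<in> space M \<Longrightarrow> 0 \<le> \<gamma>s k \<omega> \<and> \<gamma>s k \<omega> \<le> \<gamma>"
    and \<epsilon>: "\<And>k. AE \<omega> in M. \<epsilon> k \<omega> = \<omega>' * sqrt (V k \<omega> / real (b k \<omega>))"
    and a1: "a\<^sub>1 = \<gamma> + \<theta> * (\<omega>' + inverse \<mu> * ((\<epsilon>\<^sub>G + \<kappa>\<^sub>g) / \<kappa>\<^sub>\<sigma> + \<gamma>))"
    and a2: "a\<^sub>2 = a * (\<omega>' + inverse \<mu> * ((\<epsilon>\<^sub>G + \<kappa>\<^sub>g) / \<kappa>\<^sub>\<sigma> + \<gamma>))"
  shows "AE \<omega> in M.
      real_cond_exp M (\<F> 0) (\<lambda>\<omega>. norm (true_dir A lp f (R \<omega>) k (last_inner (R \<omega>) k))) \<omega>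
        \<le> max (a\<^sub>1 + \<nu>) \<beta> ^ (k + 1) * max (norm (true_dir A lp f (R \<omega>) 0 0)) (a\<^sub>2 / \<nu>)"
proof -
  interpret M: prob_space M by fact
  have sub: "subalgebra M (\<F> k)" and sub0: "subalgebra (\<F> k) (\<F> 0)" for k
    unfolding \<F>_def
    by (rule subalgebra_history subalgebra_history_0; use x0 iid in \<open>simp add: x_def \<F>_def\<close>)+
  have fms: "finite_measure_subalgebra M (\<F> k)" for k by standard (rule sub)
  interpret F0: finite_measure_subalgebra M "\<F> 0" by (rule fms)
  \<comment> \<open>Read off from the bounds on \<open>\<gamma>s\<close> at some sample point, as a
    probability space is nonempty.\<close>
  have "0 \<le> \<gamma>" using \<gamma> M.not_empty by fastforce
  have "0 \<le> a\<^sub>1" using nonneg \<mu> \<open>0 \<le> \<gamma>\<close> by (simp add: a1)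
  have DF: "D k \<in> borel_measurable (\<F> k)" for k
    using dF[of k] unfolding D_def by measurable
  have DM: "D k \<in> borel_measurable M" for k by (rule measurable_from_subalg[OF sub DF])
  have Dint: "integrable M (D k)" for k
    by (rule M.integrable_const_bound[OF AE_I2 DM, of _ "sqrt (real CARD('n)) * sigma_d A"])
      (use norm_true_dir_bound[OF run] in \<open>simp add: D_def\<close>)
  have D_nonneg: "0 \<le> D k \<omega>" for k \<omega> by (simp add: D_def)
  have step: "AE \<omega> in M. real_cond_exp M (\<F> k) (D (Suc k)) \<omega> \<le> a\<^sub>1 * D k \<omega> + a\<^sub>2 * \<beta> ^ k" for k
  proof -
    interpret Fk: finite_measure_subalgebra M "\<F> k" by (rule fms)
    define \<delta> where "\<delta> \<omega> = norm (grad f (x k \<omega>) - g k \<omega> (x k \<omega>))" for \<omega>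
    define \<Gamma> where "\<Gamma> \<omega> = G_sample X \<epsilon>\<^sub>G F f (b k \<omega>) (\<lambda>i\<in>{..<b k \<omega>}. \<xi> k i \<omega>)" for \<omega>
    define T where "T \<omega> = \<theta> * D k \<omega> + a * \<beta> ^ k" for \<omega>
    define c where "c = inverse \<mu> * (\<epsilon>\<^sub>G + \<kappa>\<^sub>g)"
    have c: "0 \<le> c" using nonneg \<mu> by (simp add: c_def)
    have xX: "x k \<omega> \<in> X" if "\<omega> \<in> space M" for \<omega>
      using inX[OF that] by (auto simp: iterates_in_def x_def)
    have \<delta>m: "\<delta> \<in> borel_measurable M" and \<delta>2: "integrable M (\<lambda>\<omega>. (\<delta> \<omega>)\<^sup>2)"
      and \<delta>V: "AE \<omega> in M. real_cond_exp M (\<F> k) (\<lambda>\<omega>. (\<delta> \<omega>)\<^sup>2) \<omega> = V k \<omega> / real (b k \<omega>)"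
      unfolding \<delta>_def g_def V
      using measurable_batch_gradient_error[where F = F and f = f and X = X and B = B, OF M P sub iid xF]
        integrable_batch_gradient_error_sq[where F = F and f = f and X = X and B = B, OF M P sub iid xF]
        real_cond_exp_batch_gradient_error_sq[where F = F and f = f and X = X and B = B, OF M P sub iid xF]
        xX gradF measurable_grad_smooth_on[OF smooth] unbiased var
      by blast+
    have \<Gamma>fin: "AE \<omega> in M. \<Gamma> \<omega> < \<infinity>"
      and \<Gamma>m: "(\<lambda>\<omega>. enn2real (\<Gamma> \<omega>)) \<in> borel_measurable M"
      and \<Gamma>2: "integrable M (\<lambda>\<omega>. (enn2real (\<Gamma> \<omega>))\<^sup>2)"
      and \<Gamma>cond: "AE \<omega> in M. real_cond_exp M (\<F> k) (\<lambda>\<omega>. (enn2real (\<Gamma> \<omega>))\<^sup>2) \<omega> \<le> \<kappa>\<^sub>G\<^sup>2 / real (b k \<omega>)"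
      unfolding \<Gamma>_def
      using AE_G_sample_finite[where F = F and f = f, OF M P sub iid Gm Gb]
        measurable_G_sample[where F = F and f = f, OF M P sub iid Gm Gb]
        integrable_G_sample_sq[where F = F and f = f, OF M P sub iid Gm Gb]
        real_cond_exp_G_sample_sq[where F = F and f = f, OF M P sub iid Gm Gb]
      by blast+
    have \<delta>1: "integrable M \<delta>" by (rule M.square_integrable_imp_integrable[OF \<delta>m \<delta>2])
    have \<Gamma>1: "integrable M (\<lambda>\<omega>. enn2real (\<Gamma> \<omega>))"
      by (rule M.square_integrable_imp_integrable[OF \<Gamma>m \<Gamma>2])
    have T_nonneg: "0 \<le> T \<omega>" for \<omega> using nonneg D_nonneg by (simp add: T_def)
    have sqrtT: "sqrt (\<theta>\<^sup>2 * (D k \<omega>)\<^sup>2 + a\<^sup>2 * \<beta> ^ (2 * k)) \<le> T \<omega>" for \<omega>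
      unfolding T_def using nonneg D_nonneg by (intro sqrt_le_add_of_squares) auto
    (* The low variance bound turns the bound on E[G_S^2] into a multiple of V / b, which is exactly
       the quantity that the batch size condition controls. *)
    have batch': "AE \<omega> in M. real_cond_exp M (\<F> k) (\<lambda>\<omega>. (\<delta> \<omega>)\<^sup>2) \<omega> \<le> (T \<omega>)\<^sup>2"
      using batch[of k] unfolding \<delta>_def
    proof eventually_elim
      case (elim \<omega>)
      then show ?case using sqrt_le_D[OF sqrtT[of \<omega>]] by linarith
    qed
    then have E\<delta>: "AE \<omega> in M. real_cond_exp M (\<F> k) \<delta> \<omega> \<le> T \<omega>"
      by (intro Fk.real_cond_exp_le_sqrt[OF \<delta>m \<delta>2]) (auto simp: T_nonneg)
    \<comment> \<open>The exact formula for the variance of a mean transfers the batch condition to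
      \<open>V / b\<close>, and so later to the tolerance \<open>\<epsilon>\<close>.\<close>
    have VT: "AE \<omega> in M. V k \<omega> / real (b k \<omega>) \<le> (T \<omega>)\<^sup>2"
      using batch' \<delta>V by eventually_elim simp
    have "AE \<omega> in M. real_cond_exp M (\<F> k) (\<lambda>\<omega>. (enn2real (\<Gamma> \<omega>))\<^sup>2) \<omega> \<le> (T \<omega> / \<kappa>\<^sub>\<sigma>)\<^sup>2 \<and> 0 \<le> T \<omega> / \<kappa>\<^sub>\<sigma>"
      using \<Gamma>cond VT Vlow[of k]
    proof eventually_elim
      case (elim \<omega>)
      have "\<kappa>\<^sub>G\<^sup>2 \<le> V k \<omega> / \<kappa>\<^sub>\<sigma>\<^sup>2" using elim(3) nonneg by (simp add: pos_le_divide_eq)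
      then have "\<kappa>\<^sub>G\<^sup>2 / real (b k \<omega>) \<le> (V k \<omega> / \<kappa>\<^sub>\<sigma>\<^sup>2) / real (b k \<omega>)"
        by (intro divide_right_mono) auto
      also have "\<dots> = (V k \<omega> / real (b k \<omega>)) / \<kappa>\<^sub>\<sigma>\<^sup>2" by simp
      also have "\<dots> \<le> (T \<omega>)\<^sup>2 / \<kappa>\<^sub>\<sigma>\<^sup>2" using elim(2) by (intro divide_right_mono) auto
      finally show ?case
        using elim(1) T_nonneg[of \<omega>] nonneg by (simp add: power_divide)
    qed
    then have E\<Gamma>: "AE \<omega> in M. real_cond_exp M (\<F> k) (\<lambda>\<omega>. enn2real (\<Gamma> \<omega>)) \<omega> \<le> T \<omega> / \<kappa>\<^sub>\<sigma>"
      by (rule Fk.real_cond_exp_le_sqrt[OF \<Gamma>m \<Gamma>2])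
    \<comment> \<open>Here \<open>p\<close> is known given \<open>\<F> k\<close> and passes through
      the conditional expectation; \<open>q\<close> carries the error at the first iterate and
      \<open>r\<close> the uniform error bound used at the last one.\<close>
    define p where "p \<omega> = \<gamma> * D k \<omega> + \<omega>' * T \<omega>" for \<omega>
    define q where "q \<omega> = \<gamma> * inverse \<mu> * \<delta> \<omega>" for \<omega>
    define r where "r \<omega> = c * enn2real (\<Gamma> \<omega>)" for \<omega>
    have Tint: "integrable M T" unfolding T_def using Dint by simp
    have int: "integrable M p" "integrable M q" "integrable M r"
      unfolding p_def q_def r_def using Dint Tint \<delta>1 \<Gamma>1 by auto
    have pF: "p \<in> borel_measurable (\<F> k)"
      using DF[of k] unfolding p_def T_def by measurable
    have "AE \<omega> in M. D (Suc k) \<omega> \<le> p \<omega> + (q \<omega> + r \<omega>)"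
      using \<Gamma>fin \<epsilon>[of k] VT AE_space
    proof eventually_elim
      case (elim \<omega>)
      let ?N = "last_inner (R \<omega>) k"
      have N: "iter (R \<omega>) k ?N \<in> X" using inX[OF elim(4)] by (auto simp: iterates_in_def)
      have "avg {..<b k \<omega>} (\<lambda>i. grad (\<lambda>z. F z ((\<lambda>i\<in>{..<b k \<omega>}. \<xi> k i \<omega>) i)) u) = g k \<omega> u" for u
        unfolding avg_def g_def by (intro arg_cong[of _ _ "scaleR _"] sum.cong) auto
      then have err_N: "norm (grad f (iter (R \<omega>) k ?N) - g k \<omega> (iter (R \<omega>) k ?N))
          \<le> (\<epsilon>\<^sub>G + \<kappa>\<^sub>g) * enn2real (\<Gamma> \<omega>)"
        using norm_gradient_error_le_G_sample[OF N nonneg(1) \<kappa>\<^sub>g[OF N], of F "b k \<omega>"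
            "\<lambda>i\<in>{..<b k \<omega>}. \<xi> k i \<omega>"] elim(1)
        by (simp add: \<Gamma>_def)
      have "D (Suc k) \<omega> \<le> \<gamma> * (D k \<omega> + inverse \<mu> * \<delta> \<omega>) + \<epsilon> k \<omega>
          + inverse \<mu> * norm (grad f (iter (R \<omega>) k ?N) - g k \<omega> (iter (R \<omega>) k ?N))"
        using norm_true_dir_recursion[OF run[OF elim(4)] hess[OF elim(4)] \<mu>, of k \<gamma> f]
          \<gamma>[OF elim(4), of k] by (simp add: D_def \<delta>_def x_def)
      moreover have "inverse \<mu> * norm (grad f (iter (R \<omega>) k ?N) - g k \<omega> (iter (R \<omega>) k ?N)) \<le> r \<omega>"
        using mult_left_mono[OF err_N, of "inverse \<mu>"] \<mu> by (simp add: r_def c_def mult.assoc)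
      moreover have "\<epsilon> k \<omega> \<le> \<omega>' * T \<omega>"
        unfolding elim(2) using elim(3) T_nonneg[of \<omega>] nonneg
        by (intro mult_left_mono real_le_lsqrt) auto
      ultimately show ?case by (simp add: p_def q_def algebra_simps)
    qed
    then have "AE \<omega> in M. real_cond_exp M (\<F> k) (D (Suc k)) \<omega>
        \<le> real_cond_exp M (\<F> k) (\<lambda>\<omega>. p \<omega> + (q \<omega> + r \<omega>)) \<omega>"
      using int by (intro Fk.real_cond_exp_mono Dint) auto
    moreover have "AE \<omega> in M. real_cond_exp M (\<F> k) (\<lambda>\<omega>. p \<omega> + (q \<omega> + r \<omega>)) \<omega>
        = real_cond_exp M (\<F> k) p \<omega> + real_cond_exp M (\<F> k) (\<lambda>\<omega>. q \<omega> + r \<omega>) \<omega>"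
      using int by (intro Fk.real_cond_exp_add) auto
    moreover have "AE \<omega> in M. real_cond_exp M (\<F> k) p \<omega> = p \<omega>"
      by (rule Fk.real_cond_exp_F_meas[OF int(1) pF])
    moreover have "AE \<omega> in M. real_cond_exp M (\<F> k) (\<lambda>\<omega>. q \<omega> + r \<omega>) \<omega>
        = real_cond_exp M (\<F> k) q \<omega> + real_cond_exp M (\<F> k) r \<omega>"
      by (rule Fk.real_cond_exp_add[OF int(2,3)])
    moreover have "AE \<omega> in M. real_cond_exp M (\<F> k) q \<omega> = \<gamma> * inverse \<mu> * real_cond_exp M (\<F> k) \<delta> \<omega>"
      unfolding q_def by (rule Fk.real_cond_exp_cmult[OF \<delta>1])
    moreover have "AE \<omega> in M. real_cond_exp M (\<F> k) r \<omega>
        = c * real_cond_exp M (\<F> k) (\<lambda>\<omega>. enn2real (\<Gamma> \<omega>)) \<omega>"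
      unfolding r_def by (rule Fk.real_cond_exp_cmult[OF \<Gamma>1])
    ultimately show ?thesis
      using E\<delta> E\<Gamma>
    proof eventually_elim
      case (elim \<omega>)
      have "\<gamma> * inverse \<mu> * real_cond_exp M (\<F> k) \<delta> \<omega> \<le> \<gamma> * inverse \<mu> * T \<omega>"
        using elim(7) \<mu> \<open>0 \<le> \<gamma>\<close> by (intro mult_left_mono) auto
      moreover have "c * real_cond_exp M (\<F> k) (\<lambda>\<omega>. enn2real (\<Gamma> \<omega>)) \<omega> \<le> c * (T \<omega> / \<kappa>\<^sub>\<sigma>)"
        using elim(8) c by (intro mult_left_mono) auto
      ultimately have "real_cond_exp M (\<F> k) (D (Suc k)) \<omega>
          \<le> p \<omega> + (\<gamma> * inverse \<mu> * T \<omega> + c * (T \<omega> / \<kappa>\<^sub>\<sigma>))"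
        using elim(1-6) by linarith
      also have "\<dots> = a\<^sub>1 * D k \<omega> + a\<^sub>2 * \<beta> ^ k"
        by (simp add: p_def c_def a1 a2 T_def divide_inverse algebra_simps)
      finally show ?case .
    qed
  qed
  have rate: "AE \<omega> in M. real_cond_exp M (\<F> 0) (D k) \<omega>
      \<le> max (a\<^sub>1 + \<nu>) \<beta> ^ k * max (D 0 \<omega>) (a\<^sub>2 / \<nu>)" for k
  proof (induction k)
    case 0
    show ?case using F0.real_cond_exp_F_meas[OF Dint DF] by eventually_elim simp
  next
    case (Suc k)
    interpret Fk: finite_measure_subalgebra M "\<F> k" by (rule fms)
    have int: "integrable M (\<lambda>\<omega>. a\<^sub>1 * D k \<omega>)" "integrable M (\<lambda>_. a\<^sub>2 * \<beta> ^ k)"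
      using Dint by auto
    \<comment> \<open>The one-step bound is conditioned once more, on the smaller algebra
      \<open>\<F> 0\<close>; the nested expectation on the left then collapses.\<close>
    have "AE \<omega> in M. real_cond_exp M (\<F> 0) (real_cond_exp M (\<F> k) (D (Suc k))) \<omega>
        \<le> real_cond_exp M (\<F> 0) (\<lambda>\<omega>. a\<^sub>1 * D k \<omega> + a\<^sub>2 * \<beta> ^ k) \<omega>"
      using int by (intro F0.real_cond_exp_mono step Fk.real_cond_exp_int(1) Dint) auto
    moreover have "AE \<omega> in M. real_cond_exp M (\<F> 0) (real_cond_exp M (\<F> k) (D (Suc k))) \<omega>
        = real_cond_exp M (\<F> 0) (D (Suc k)) \<omega>"
      by (rule F0.real_cond_exp_nested_subalg[OF sub sub0 Dint])
    moreover have "AE \<omega> in M. real_cond_exp M (\<F> 0) (\<lambda>\<omega>. a\<^sub>1 * D k \<omega> + a\<^sub>2 * \<beta> ^ k) \<omega>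
        = real_cond_exp M (\<F> 0) (\<lambda>\<omega>. a\<^sub>1 * D k \<omega>) \<omega> + real_cond_exp M (\<F> 0) (\<lambda>_. a\<^sub>2 * \<beta> ^ k) \<omega>"
      by (rule F0.real_cond_exp_add[OF int])
    moreover have "AE \<omega> in M. real_cond_exp M (\<F> 0) (\<lambda>\<omega>. a\<^sub>1 * D k \<omega>) \<omega>
        = a\<^sub>1 * real_cond_exp M (\<F> 0) (D k) \<omega>"
      by (rule F0.real_cond_exp_cmult[OF Dint])
    moreover have "AE \<omega> in M. real_cond_exp M (\<F> 0) (\<lambda>_. a\<^sub>2 * \<beta> ^ k) \<omega> = a\<^sub>2 * \<beta> ^ k"
      by (rule F0.real_cond_exp_F_meas[OF int(2)]) simp
    ultimately show ?case
      using Suc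
    proof eventually_elim
      case (elim \<omega>)
      then have "real_cond_exp M (\<F> 0) (D (Suc k)) \<omega>
          \<le> a\<^sub>1 * real_cond_exp M (\<F> 0) (D k) \<omega> + a\<^sub>2 * \<beta> ^ k" by linarith
      \<comment> \<open>The scalar recursion is applied pointwise, with the initial constant
        depending on \<omega>.\<close>
      from geometric_rate_step[OF \<open>0 \<le> a\<^sub>1\<close> \<open>0 < \<nu>\<close> _ _ _ this elim(6)] show ?case
        using \<open>0 < \<beta>\<close> D_nonneg[of 0 \<omega>] by (simp add: le_max_iff_disj)
    qed
  qed
  have last: "D (Suc k) \<omega> = norm (true_dir A lp f (R \<omega>) k (last_inner (R \<omega>) k))"
    if "\<omega> \<in> space M" for \<omega>
    by (simp add: D_def true_dir_carry_over[OF run[OF that]])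
  have "AE \<omega> in M. real_cond_exp M (\<F> 0) (D (Suc k)) \<omega> =
      real_cond_exp M (\<F> 0) (\<lambda>\<omega>. norm (true_dir A lp f (R \<omega>) k (last_inner (R \<omega>) k))) \<omega>"
    using DM[of "Suc k"] by (intro F0.real_cond_exp_cong AE_I2 last) (auto simp: measurable_cong[OF last])
  then show ?thesis
    using rate[of "Suc k"] by eventually_elim (simp add: D_def)
qed

section \<open>Specialization of the two rates to the finite-sum and expectation problems\<close>

theorem theorem3p5:
  fixes A :: "('n::finite) sqp"
    and lp :: "real^'n \<Rightarrow> (real^'n) \<times> slack"
    and X :: "(real^'n) set"
    and \<mu>\<^sub>H \<kappa>\<^sub>H \<kappa>\<^sub>g :: real
  assumes "valid_inputs A"
    and "closed X" "bounded X" "convex X"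
    and "smooth_map_on X (m_E A) (c_E A)" "smooth_map_on X (m_I A) (c_I A)"
    and "0 < \<mu>\<^sub>H" "\<mu>\<^sub>H \<le> \<kappa>\<^sub>H"
    and "\<forall>x\<in>X. extended_MFCQ A x"
    and "0 \<le> \<kappa>\<^sub>g"
  shows
    "(\<forall>(F :: real^'n \<Rightarrow> 'a \<Rightarrow> real) (\<S> :: 'a set) (f :: real^'n \<Rightarrow> real)
       (S :: nat \<Rightarrow> 'a set) (R :: 'n run) (\<gamma>s :: nat \<Rightarrow> real) (\<epsilon> :: nat \<Rightarrow> real)
       (\<omega>\<^sub>1 :: real) (\<omega>\<^sub>2 :: real) (\<theta> :: real) (\<theta>' :: real) (a :: real) (\<beta> :: real)
       (\<gamma> :: real) (\<omega> :: real) (\<omega>' :: real) (a\<^sub>1 :: real) (a\<^sub>2 :: real) (\<nu> :: real).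
        finite \<S> \<and> \<S> \<noteq> {} \<and> (\<forall>x. f x = avg \<S> (F x)) \<and>
        (\<forall>\<xi>\<in>\<S>. \<forall>x\<in>X. (\<lambda>z. F z \<xi>) differentiable (at x)) \<and>
        (\<forall>k. S k \<subseteq> \<S> \<and> S k \<noteq> {}) \<and>
        sqp_run A lp \<gamma>s \<epsilon> (\<lambda>k x. avg (S k) (F x)) (\<lambda>k x. avg (S k) (\<lambda>\<xi>. grad (\<lambda>z. F z \<xi>) x)) R \<and>
        iterates_in X R \<and> hessians_bounded \<mu>\<^sub>H \<kappa>\<^sub>H R \<and>
        smooth_on X f \<and> (\<forall>k. smooth_on X (\<lambda>x. avg (S k) (F x))) \<and>
        (\<forall>x\<in>X. norm (grad f x) \<le> \<kappa>\<^sub>g) \<and>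
        0 \<le> \<omega>\<^sub>1 \<and> 0 \<le> \<omega>\<^sub>2 \<and>
        (\<forall>x\<in>X. \<forall>\<xi>\<in>\<S>. (norm (grad (\<lambda>z. F z \<xi>) x))\<^sup>2 \<le> \<omega>\<^sub>1\<^sup>2 * (norm (grad f x))\<^sup>2 + \<omega>\<^sub>2\<^sup>2) \<and>
        0 \<le> \<theta> \<and> 0 \<le> \<theta>' \<and> 0 \<le> a \<and> 0 < \<beta> \<and> \<beta> < 1 \<and>
        (\<forall>k. (norm (grad f (iter R k 0) - avg (S k) (\<lambda>\<xi>. grad (\<lambda>z. F z \<xi>) (iter R k 0))))\<^sup>2
              \<le> \<theta>\<^sup>2 * (norm (true_dir A lp f R k 0))\<^sup>2 + a\<^sup>2 * \<beta> ^ (2 * k)) \<and>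
        (\<forall>k. (norm (grad f (iter R k (last_inner R k)) - avg (S k) (\<lambda>\<xi>. grad (\<lambda>z. F z \<xi>) (iter R k (last_inner R k)))))\<^sup>2
              \<le> \<theta>'\<^sup>2 * (\<theta>\<^sup>2 * (norm (true_dir A lp f R k 0))\<^sup>2 + a\<^sup>2 * \<beta> ^ (2 * k))) \<and>
        (\<forall>k. 0 \<le> \<gamma>s k \<and> \<gamma>s k \<le> \<gamma>) \<and> \<gamma> < 1 \<and>
        0 \<le> \<omega> \<and> 0 \<le> \<omega>' \<and>
        (\<forall>k. \<epsilon> k = \<omega> * norm (grad f (iter R k 0) - avg (S k) (\<lambda>\<xi>. grad (\<lambda>z. F z \<xi>) (iter R k 0)))
                    + \<omega>' * \<beta> ^ k) \<and>
        a\<^sub>1 = \<gamma> + \<theta> * (\<omega> + inverse \<mu>\<^sub>H * (\<theta>' + \<gamma>)) \<and> a\<^sub>1 < 1 \<and>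
        a\<^sub>2 = a * (\<omega> + inverse \<mu>\<^sub>H * (\<theta>' + \<gamma>)) + \<omega>' \<and>
        0 < \<nu> \<and> a\<^sub>1 + \<nu> < 1
        \<longrightarrow>
        (\<forall>k. norm (true_dir A lp f R k (last_inner R k))
              \<le> max (a\<^sub>1 + \<nu>) \<beta> ^ (k + 1) * max (norm (true_dir A lp f R 0 0)) (a\<^sub>2 / \<nu>)))
   \<and>
     (\<forall>(M :: 'w measure) (P :: 'b measure) (F :: real^'n \<Rightarrow> 'b \<Rightarrow> real) (f :: real^'n \<Rightarrow> real)
       (b :: nat \<Rightarrow> 'w \<Rightarrow> nat) (\<xi> :: nat \<Rightarrow> nat \<Rightarrow> 'w \<Rightarrow> 'b) (R :: 'w \<Rightarrow> 'n run)
       (\<F> :: nat \<Rightarrow> 'w measure) (g :: nat \<Rightarrow> 'w \<Rightarrow> real^'n \<Rightarrow> real^'n) (V :: nat \<Rightarrow> 'w \<Rightarrow> real)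
       (\<gamma>s :: nat \<Rightarrow> 'w \<Rightarrow> real) (\<epsilon> :: nat \<Rightarrow> 'w \<Rightarrow> real)
       (\<omega>\<^sub>1 :: real) (\<omega>\<^sub>2 :: real) (\<epsilon>\<^sub>G :: real) (\<kappa>\<^sub>G :: real) (\<kappa>\<^sub>\<sigma> :: real)
       (\<theta> :: real) (a :: real) (\<beta> :: real) (\<gamma> :: real) (\<omega>' :: real)
       (a\<^sub>1 :: real) (a\<^sub>2 :: real) (\<nu> :: real).
        prob_space M \<and> prob_space P \<and>
        (\<forall>x. integrable P (F x) \<and> f x = (\<integral>\<zeta>. F x \<zeta> \<partial>P)) \<and>
        (\<forall>\<zeta>\<in>space P. \<forall>x\<in>X. (\<lambda>z. F z \<zeta>) differentiable (at x)) \<and>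
        (\<lambda>(x, \<zeta>). grad (\<lambda>z. F z \<zeta>) x) \<in> borel_measurable (restrict_space borel X \<Otimes>\<^sub>M P) \<and>
        (\<forall>x\<in>X. integrable P (\<lambda>\<zeta>. grad (\<lambda>z. F z \<zeta>) x) \<and>
                grad f x = (\<integral>\<zeta>. grad (\<lambda>z. F z \<zeta>) x \<partial>P)) \<and>
        (\<lambda>\<omega>. iter (R \<omega>) 0 0) \<in> borel_measurable M \<and>
        \<F> = history M P (\<lambda>\<omega>. iter (R \<omega>) 0 0) b \<xi> \<and>
        (\<forall>k. iid_batch M P (\<F> k) (b k) (\<xi> k)) \<and>
        (\<forall>k. (\<lambda>\<omega>. iter (R \<omega>) k 0) \<in> borel_measurable (\<F> k) \<and>
             (\<lambda>\<omega>. true_dir A lp f (R \<omega>) k 0) \<in> borel_measurable (\<F> k)) \<and>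
        (\<forall>k \<omega> x. g k \<omega> x = avg {..<b k \<omega>} (\<lambda>i. grad (\<lambda>z. F z (\<xi> k i \<omega>)) x)) \<and>
        (\<forall>k. V k = grad_cond_var M (\<F> k) F f (\<lambda>\<omega>. iter (R \<omega>) k 0) (\<xi> k 0)) \<and>
        (\<forall>\<omega>\<in>space M.
           sqp_run A lp (\<lambda>k. \<gamma>s k \<omega>) (\<lambda>k. \<epsilon> k \<omega>)
             (\<lambda>k x. avg {..<b k \<omega>} (\<lambda>i. F x (\<xi> k i \<omega>))) (\<lambda>k. g k \<omega>) (R \<omega>) \<and>
           iterates_in X (R \<omega>) \<and> hessians_bounded \<mu>\<^sub>H \<kappa>\<^sub>H (R \<omega>) \<and>
           (\<forall>k. smooth_on X (\<lambda>x. avg {..<b k \<omega>} (\<lambda>i. F x (\<xi> k i \<omega>))))) \<and>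
        smooth_on X f \<and>
        (\<forall>x\<in>X. norm (grad f x) \<le> \<kappa>\<^sub>g) \<and>
        0 \<le> \<omega>\<^sub>1 \<and> 0 \<le> \<omega>\<^sub>2 \<and>
        (\<forall>x\<in>X. integrable P (\<lambda>\<zeta>. (norm (grad f x - grad (\<lambda>z. F z \<zeta>) x))\<^sup>2) \<and>
                (\<integral>\<zeta>. (norm (grad f x - grad (\<lambda>z. F z \<zeta>) x))\<^sup>2 \<partial>P)
                  \<le> \<omega>\<^sub>1\<^sup>2 * (norm (grad f x))\<^sup>2 + \<omega>\<^sub>2\<^sup>2) \<and>
        0 < \<epsilon>\<^sub>G \<and> 0 \<le> \<kappa>\<^sub>G \<and> 0 < \<kappa>\<^sub>\<sigma> \<and>
        (\<forall>m>0. G_sample X \<epsilon>\<^sub>G F f m \<in> borel_measurable (PiM {..<m} (\<lambda>_. P)) \<and>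
               (\<integral>\<^sup>+ s. (G_sample X \<epsilon>\<^sub>G F f m s)\<^sup>2 \<partial>(PiM {..<m} (\<lambda>_. P))) \<le> ennreal (\<kappa>\<^sub>G\<^sup>2 / real m)) \<and>
        (\<forall>k. AE \<omega> in M. V k \<omega> \<ge> \<kappa>\<^sub>G\<^sup>2 * \<kappa>\<^sub>\<sigma>\<^sup>2) \<and>
        0 \<le> \<theta> \<and> 0 \<le> a \<and> 0 < \<beta> \<and> \<beta> < 1 \<and>
        (\<forall>k. AE \<omega> in M.
           real_cond_exp M (\<F> k)
             (\<lambda>\<omega>. (norm (grad f (iter (R \<omega>) k 0) - g k \<omega> (iter (R \<omega>) k 0)))\<^sup>2) \<omega>
             \<le> \<theta>\<^sup>2 * (norm (true_dir A lp f (R \<omega>) k 0))\<^sup>2 + a\<^sup>2 * \<beta> ^ (2 * k)) \<and>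
        (\<forall>k. \<forall>\<omega>\<in>space M. 0 \<le> \<gamma>s k \<omega> \<and> \<gamma>s k \<omega> \<le> \<gamma>) \<and> \<gamma> < 1 \<and>
        0 \<le> \<omega>' \<and>
        (\<forall>k. AE \<omega> in M. \<epsilon> k \<omega> = \<omega>' * sqrt (V k \<omega> / real (b k \<omega>))) \<and>
        a\<^sub>1 = \<gamma> + \<theta> * (\<omega>' + inverse \<mu>\<^sub>H * ((\<epsilon>\<^sub>G + \<kappa>\<^sub>g) / \<kappa>\<^sub>\<sigma> + \<gamma>)) \<and> a\<^sub>1 < 1 \<and>
        a\<^sub>2 = a * (\<omega>' + inverse \<mu>\<^sub>H * ((\<epsilon>\<^sub>G + \<kappa>\<^sub>g) / \<kappa>\<^sub>\<sigma> + \<gamma>)) \<and>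
        0 < \<nu> \<and> a\<^sub>1 + \<nu> < 1
        \<longrightarrow>
        (\<forall>k. AE \<omega> in M.
           real_cond_exp M (\<F> 0) (\<lambda>\<omega>. norm (true_dir A lp f (R \<omega>) k (last_inner (R \<omega>) k))) \<omega>
             \<le> max (a\<^sub>1 + \<nu>) \<beta> ^ (k + 1) * max (norm (true_dir A lp f (R \<omega>) 0 0)) (a\<^sub>2 / \<nu>)))"
proof ((intro conjI allI impI; elim conjE), goal_cases)
  case (1 F \<S> f S R \<gamma>s \<epsilon> \<omega>\<^sub>1 \<omega>\<^sub>2 \<theta> \<theta>' a \<beta> \<gamma> \<omega> \<omega>' a\<^sub>1 a\<^sub>2 \<nu> k)
  show ?case
    by (rule finite_sum_rate[OF 1(6,8) \<open>0 < \<mu>\<^sub>H\<close> 1(15-18,24,30) spec[OF 1(20)] spec[OF 1(21)]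
          spec[OF 1(22)] spec[OF 1(26)] 1(27,29)])
next
  case (2 M P F f b \<xi> R \<F> g V \<gamma>s \<epsilon> \<omega>\<^sub>1 \<omega>\<^sub>2 \<epsilon>\<^sub>G \<kappa>\<^sub>G \<kappa>\<^sub>\<sigma> \<theta> a \<beta> \<gamma> \<omega>' a\<^sub>1 a\<^sub>2 \<nu> k)
  have g: "g = (\<lambda>k \<omega> x. avg {..<b k \<omega>} (\<lambda>i. grad (\<lambda>z. F z (\<xi> k i \<omega>)) x))"
    using 2(11) by (simp add: fun_eq_iff)
  note \<F> = 2(8)
  \<comment> \<open>Inserting \<open>\<kappa>\<^sub>g\<close> for the gradient norm makes the
    variance bound uniform on \<open>X\<close>; this is the constant \<open>B\<close> of the rate
    lemma.\<close>
  have var: "integrable P (\<lambda>\<zeta>. (norm (grad f x - grad (\<lambda>z. F z \<zeta>) x))\<^sup>2) \<and>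
      (\<integral>\<zeta>. (norm (grad f x - grad (\<lambda>z. F z \<zeta>) x))\<^sup>2 \<partial>P) \<le> \<omega>\<^sub>1\<^sup>2 * \<kappa>\<^sub>g\<^sup>2 + \<omega>\<^sub>2\<^sup>2"
    if "x \<in> X" for x
  proof -
    have "(norm (grad f x))\<^sup>2 \<le> \<kappa>\<^sub>g\<^sup>2" using bspec[OF 2(15) that] by (intro power_mono) auto
    then have "\<omega>\<^sub>1\<^sup>2 * (norm (grad f x))\<^sup>2 \<le> \<omega>\<^sub>1\<^sup>2 * \<kappa>\<^sub>g\<^sup>2" by (intro mult_left_mono) auto
    then show ?thesis using bspec[OF 2(18) that] by linarith
  qed
  have run: "sqp_run A lp (\<lambda>k. \<gamma>s k \<omega>) (\<lambda>k. \<epsilon> k \<omega>)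
      (\<lambda>k x. avg {..<b k \<omega>} (\<lambda>i. F x (\<xi> k i \<omega>))) (\<lambda>k. g k \<omega>) (R \<omega>)"
    and inX: "iterates_in X (R \<omega>)" and hess: "hessians_bounded \<mu>\<^sub>H \<kappa>\<^sub>H (R \<omega>)"
    if "\<omega> \<in> space M" for \<omega>
    using bspec[OF 2(13) that] by blast+
  have meas: "(\<lambda>\<omega>. iter (R \<omega>) k 0) \<in> borel_measurable (\<F> k)"
      "(\<lambda>\<omega>. true_dir A lp f (R \<omega>) k 0) \<in> borel_measurable (\<F> k)" for k
    using spec[OF 2(10), of k] by auto
  have G: "G_sample X \<epsilon>\<^sub>G F f m \<in> borel_measurable (PiM {..<m} (\<lambda>_. P))"
      "(\<integral>\<^sup>+ s. (G_sample X \<epsilon>\<^sub>G F f m s)\<^sup>2 \<partial>(PiM {..<m} (\<lambda>_. P))) \<le> ennreal (\<kappa>\<^sub>G\<^sup>2 / real m)"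
    if "0 < m" for m
    using 2(22) that by auto
  have \<gamma>: "0 \<le> \<gamma>s k \<omega> \<and> \<gamma>s k \<omega> \<le> \<gamma>" if "\<omega> \<in> space M" for k \<omega>
    using 2(29) that by blast
  show ?case
    unfolding \<F>
    by (rule expectation_rate[OF 2(1,2) \<open>0 < \<mu>\<^sub>H\<close> 2(14,5) bspec[OF 2(6)] var bspec[OF 2(15)] 2(7)
          spec[OF 2(9)[unfolded \<F>]] meas[unfolded \<F>] spec[OF 2(12)[unfolded \<F>]]
          run[unfolded g] inX hess G spec[OF 2(23)] spec[OF 2(28)[unfolded \<F> g]]
          2(19,21,24,25,26,31,36) \<open>0 \<le> \<kappa>\<^sub>g\<close> \<gamma> spec[OF 2(32)] 2(33,35)])
qed

end
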